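(* Let $p\in(0,1]$ and let $D_{n,p}$ denote the depth of a uniformly chosen vertex in the $p$-percolated uniform temporal tree $\mathcal{T}_{n,p}$ (that is, conditionally on $\mathcal{T}_{n,p}$, the vertex is chosen uniformly at random among the vertices of $\mathcal{T}_{n,p}$). Then $$\frac{D_{n,p}}{np}\to 1 \quad\text{and}\quad \frac{D_{n,p}}{\log|\mathcal{T}_{n,p}|}\to 1$$ in probability as $n\to\infty$.
   Context: For a positive integer $n$, let $T_n$ be the rooted infinite complete $n$-ary tree (every vertex has exactly $n$ children). To each edge $e$ of $T_n$ assign an independent random variable $U_e$ uniformly distributed on $[0,1]$. The label $\ell_v$ of a non-root vertex $v$ is $U_e$, where $e$ is the edge joining $v$ to its parent. For $p\in(0,1]$, assign the root the label $p$. The $p$-percolated uniform temporal tree $\mathcal{T}_{n,p}$ is the random rooted tree obtained from $T_n$ by deleting all vertices $v$ for which the vertex labels along the path from the root to $v$ are not decreasing. (Thus a vertex $v$ of $T_n$ is kept exactly when the labels read along the path from the root to $v$, starting with the label $p$ of the root, are decreasing.) The tree is almost surely finite. $|\mathcal{T}_{n,p}|$ denotes its number of vertices. The depth of a vertex is the number of edges on the path from the root to it. $\log$ is the natural logarithm. On the event $|\mathcal{T}_{n,p}|=1$ the ratio $D_{n,p}/\log|\mathcal{T}_{n,p}|$ is given an arbitrary fixed value, e.g. $0$. *)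

theory Defs
  imports "HOL-Probability.Probability" "HOL-Library.Sublist"
begin

text \<open>
  A vertex of the complete n-ary tree is the list of child indices read along the path from the
  root \<^term>\<open>[]\<close> to it; the children of \<open>v\<close> are \<open>v @ [i]\<close> for \<open>i < n\<close>, and the depth of a
  vertex is its length.  The edge joining a non-root vertex to its parent is identified with
  that vertex.
\<close>

definition nary_tree :: "nat \<Rightarrow> nat list set" where
  "nary_tree n = lists {..<n}"

definition nary_edges :: "nat \<Rightarrow> nat list set" where
  "nary_edges n = nary_tree n - {[]}"

definition vertex_label :: "real \<Rightarrow> (nat list \<Rightarrow> real) \<Rightarrow> nat list \<Rightarrow> real" where
  "vertex_label p u v = (if v = [] then p else u v)"

text \<open>
  \<^term>\<open>prefixes v\<close> lists the vertices on the path from the root to \<open>v\<close>, in this order.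
\<close>

definition temporal_tree :: "nat \<Rightarrow> real \<Rightarrow> (nat list \<Rightarrow> real) \<Rightarrow> nat list set" where
  "temporal_tree n p u =
     {v \<in> nary_tree n. sorted_wrt (>) (map (vertex_label p u) (prefixes v))}"

definition iid_uniform_labels ::
    "'a measure \<Rightarrow> 'e set \<Rightarrow> ('e \<Rightarrow> 'a \<Rightarrow> real) \<Rightarrow> bool" where
  "iid_uniform_labels M E U \<longleftrightarrow>
     prob_space.indep_vars M (\<lambda>_. borel) U E \<and>
     (\<forall>e\<in>E. distr M borel (U e) = uniform_measure lborel {0..1})"

text \<open>
  \<open>V\<close> is, conditionally on the random set \<open>T\<close>, uniformly distributed on \<open>T\<close>.  Conditioning on
  the elementary events \<open>T = S\<close> with \<open>S\<close> finite determines the joint law of \<open>(T, V)\<close> as soon as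
  \<open>T\<close> is almost surely a finite set of vertices, since there are only countably many of those.
\<close>

definition uniform_choice ::
    "'a measure \<Rightarrow> ('a \<Rightarrow> nat list set) \<Rightarrow> ('a \<Rightarrow> nat list) \<Rightarrow> bool" where
  "uniform_choice M T V \<longleftrightarrow>
     V \<in> measurable M (count_space UNIV) \<and>
     (\<forall>S. finite S \<longrightarrow> \<P>(\<omega> in M. T \<omega> = S) > 0 \<longrightarrow>
        (\<forall>v\<in>S. \<P>(\<omega> in M. V \<omega> = v \<bar> T \<omega> = S) = 1 / real (card S)))"

text \<open>
  Convergence in probability to a constant, where the random variables may live on different
  probability spaces.  Measurability is demanded explicitly because \<^const>\<open>measure\<close> is 0 on
  non-measurable sets.
\<close>

definition converges_in_probability ::
    "(nat \<Rightarrow> 'a measure) \<Rightarrow> (nat \<Rightarrow> 'a \<Rightarrow> real) \<Rightarrow> real \<Rightarrow> bool" where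
  "converges_in_probability M X c \<longleftrightarrow>
     (\<forall>\<^sub>F n in sequentially. X n \<in> borel_measurable (M n)) \<and>
     (\<forall>\<epsilon>>0. (\<lambda>n. \<P>(\<omega> in M n. \<bar>X n \<omega> - c\<bar> > \<epsilon>)) \<longlonglongrightarrow> 0)"

end

theory Submission
  imports Defs "HOL-Real_Asymp.Real_Asymp"
begin

text \<open>
  The expected number of vertices of depth \<open>k\<close> is \<open>(n p)^k / k!\<close>, because a vertex at depth \<open>k\<close>
  survives when \<open>k\<close> independent uniform labels are below \<open>p\<close> and decreasing.  The expected depth
  profile is therefore \<open>exp (n p)\<close> times the Poisson distribution with mean \<open>n p\<close>, which is
  concentrated near \<open>n p\<close> up to an exponentially small share.  By Markov's inequality, with high
  probability the number of vertices whose depth differs from \<open>n p\<close> by more than \<open>\<epsilon> n p\<close> is at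
  most \<open>exp ((1 - c) n p)\<close> for some \<open>c > 0\<close> (\<open>tree_weight_upper_tail\<close>), and the whole tree has at
  most \<open>exp ((1 + \<delta>) n p)\<close> vertices.

  To conclude for a uniformly chosen vertex, the tree must not be much smaller than its mean: with
  high probability it has at least \<open>exp ((1 - \<delta>) n p)\<close> vertices for every \<open>\<delta> > 0\<close>.  The branching
  structure at the root gives an integral inequality for the second moment of the size, which
  bounds it by \<open>2 exp (2 n p)\<close> (\<open>second_moment_trunc_size\<close>), so the size is at least half
  its mean with probability bounded below by a constant.  Among the \<open>n\<close> children of the root, each
  has a label in \<open>(p - \<delta>, p)\<close> and a subtree of size at least \<open>exp (n (p - \<delta>)) / 2\<close> with probability
  of order \<open>\<delta>\<close>, independently of the other children; hence one of them succeeds with high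
  probability (\<open>card_temporal_tree_lower_tail\<close>).

  So the vertices of atypical depth form an exponentially small share of the tree, and a uniform
  vertex misses them with high probability, which proves the first limit.  The two bounds on the
  size give that its logarithm divided by \<open>n p\<close> tends to \<open>1\<close>, and the second limit follows.
\<close>

section \<open>Subtrees of the temporal tree\<close>

text \<open>
  The labels of the subtree hanging at the child \<open>i\<close> of the root, with its vertices renamed so
  that it becomes a copy of the whole tree.  Restricting to the edges makes the result a point of
  the same product space as the original labelling.
\<close>

definition subtree_labels :: "nat \<Rightarrow> nat \<Rightarrow> (nat list \<Rightarrow> real) \<Rightarrow> nat list \<Rightarrow> real" where
  "subtree_labels n i u = (\<lambda>w\<in>nary_edges n. u (i # w))"

lemma Nil_in_nary_tree [simp]: "[] \<in> nary_tree n"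
  by (simp add: nary_tree_def)

lemma Cons_in_nary_tree [simp]: "i # w \<in> nary_tree n \<longleftrightarrow> i < n \<and> w \<in> nary_tree n"
  by (simp add: nary_tree_def)

lemma Cons_in_nary_edges [simp]: "i # w \<in> nary_edges n \<longleftrightarrow> i < n \<and> w \<in> nary_tree n"
  by (simp add: nary_edges_def)

lemma prefix_in_nary_tree: "prefix w v \<Longrightarrow> v \<in> nary_tree n \<Longrightarrow> w \<in> nary_tree n"
  by (auto simp: nary_tree_def prefix_def)

lemma finite_nary_tree_level [simp]: "finite {v \<in> nary_tree n. length v = k}"
  using finite_lists_length_eq[of "{..<n}" k] by (simp add: nary_tree_def lists_eq_set conj_commute)

lemma card_nary_tree_level: "card {v \<in> nary_tree n. length v = k} = n ^ k"
  using card_lists_length_eq[of "{..<n}" k] by (simp add: nary_tree_def lists_eq_set)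

lemma temporal_tree_subset: "temporal_tree n x u \<subseteq> nary_tree n"
  by (auto simp: temporal_tree_def)

lemma temporal_tree_cong:
  assumes "\<And>e. e \<in> nary_edges n \<Longrightarrow> u e = u' e"
  shows "temporal_tree n x u = temporal_tree n x u'"
proof -
  have "map (vertex_label x u) (prefixes v) = map (vertex_label x u') (prefixes v)"
    if "v \<in> nary_tree n" for v
    using prefix_in_nary_tree[OF _ that] assms
    by (auto simp: vertex_label_def nary_edges_def)
  then show ?thesis
    unfolding temporal_tree_def by (intro Collect_cong conj_cong refl) metis
qed

lemma Nil_in_temporal_tree [simp]: "[] \<in> temporal_tree n x u"
  by (simp add: temporal_tree_def)

text \<open>
  The recursive structure behind every computation below: the part of the temporal tree beyond
  the child \<open>i\<close> is again a temporal tree, whose root label is the label of that child.  Since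
  decreasing chains are transitive, comparing the child with the root is enough.
\<close>

lemma Cons_in_temporal_tree:
  "i # w \<in> temporal_tree n x u \<longleftrightarrow>
     i < n \<and> u [i] < x \<and> w \<in> temporal_tree n (u [i]) (subtree_labels n i u)"
proof -
  define ys where "ys = map (vertex_label (u [i]) (\<lambda>w. u (i # w))) (prefixes w)"
  have ys: "map (vertex_label x u) (prefixes (i # w)) = x # ys"
    by (auto simp: ys_def vertex_label_def)
  obtain zs where zs: "ys = u [i] # zs"
    by (cases w) (auto simp: ys_def vertex_label_def)
  have "sorted_wrt (>) (x # ys) \<longleftrightarrow> u [i] < x \<and> sorted_wrt (>) ys"
    by (auto simp: zs)
  moreover have "temporal_tree n (u [i]) (subtree_labels n i u)
      = temporal_tree n (u [i]) (\<lambda>w. u (i # w))"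
    by (rule temporal_tree_cong) (simp add: subtree_labels_def)
  ultimately show ?thesis
    by (simp only: temporal_tree_def mem_Collect_eq ys Cons_in_nary_tree)
      (auto simp: ys_def)
qed

lemma temporal_tree_mono:
  assumes "x \<le> y"
  shows "temporal_tree n x u \<subseteq> temporal_tree n y u"
proof
  fix v assume "v \<in> temporal_tree n x u"
  then show "v \<in> temporal_tree n y u"
    using assms by (cases v) (auto simp: Cons_in_temporal_tree)
qed

section \<open>The law of the labels\<close>

text \<open>
  All probabilities are computed on the canonical space of labellings and transferred to an
  arbitrary probability space at the end.
\<close>

definition label_measure :: "nat \<Rightarrow> (nat list \<Rightarrow> real) measure" where
  "label_measure n = (\<Pi>\<^sub>M e\<in>nary_edges n. uniform_measure lborel {0..1})"

lemma prob_space_uniform: "prob_space (uniform_measure lborel {0..1::real})"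
  by (rule prob_space_uniform_measure) auto

interpretation labels: prob_space "label_measure n" for n
  unfolding label_measure_def by (intro prob_space_PiM prob_space_uniform)

lemma sets_label_measure [measurable_cong]:
  "sets (label_measure n) = sets (\<Pi>\<^sub>M e\<in>nary_edges n. borel)"
  unfolding label_measure_def by (rule sets_PiM_cong) auto

lemma measurable_label [measurable]:
  "e \<in> nary_edges n \<Longrightarrow> (\<lambda>u. u e) \<in> borel_measurable (label_measure n)"
  by measurable

lemma measurable_subtree_labels [measurable]:
  assumes "i < n"
  shows "subtree_labels n i \<in> label_measure n \<rightarrow>\<^sub>M label_measure n"
proof -
  have "(\<lambda>u. \<lambda>w\<in>nary_edges n. u (i # w)) \<in> label_measure n \<rightarrow>\<^sub>M (\<Pi>\<^sub>M e\<in>nary_edges n. borel)"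
    using assms by (intro measurable_restrict measurable_label) (auto simp: nary_edges_def)
  then show ?thesis
    by (simp add: subtree_labels_def[abs_def] cong: measurable_cong_sets[OF refl sets_label_measure])
qed

text \<open>
  Joint measurability in the root label and the labelling: in the recursion the root label of a
  subtree is itself random, and averaging over it requires Fubini's theorem.
\<close>

lemma measurable_mem_temporal_tree:
  assumes "v \<in> nary_tree n"
  shows "Measurable.pred (borel \<Otimes>\<^sub>M label_measure n) (\<lambda>(x, u). v \<in> temporal_tree n x u)"
  using assms
proof (induction v)
  case Nil
  then show ?case by simp
next
  case (Cons i w)
  then have i [measurable]: "i < n" "[i] \<in> nary_edges n" and w: "w \<in> nary_tree n"
    by auto
  note [measurable] = Cons.IH[OF w]
  have "Measurable.pred (borel \<Otimes>\<^sub>M label_measure n)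
      (\<lambda>z. snd z [i] < fst z \<and> (case (snd z [i], subtree_labels n i (snd z)) of
        (x, u) \<Rightarrow> w \<in> temporal_tree n x u))"
    using i by measurable
  then show ?case
    using i by (simp add: Cons_in_temporal_tree case_prod_beta')
qed

lemma measurable_mem_temporal_tree' [measurable (raw)]:
  assumes "v \<in> nary_tree n"
  assumes [measurable]: "f \<in> borel_measurable N" "g \<in> N \<rightarrow>\<^sub>M label_measure n"
  shows "Measurable.pred N (\<lambda>z. v \<in> temporal_tree n (f z) (g z))"
  using measurable_compose[OF measurable_Pair measurable_mem_temporal_tree[OF assms(1)], OF assms(2,3)]
  by simp

lemma distr_label:
  assumes "e \<in> nary_edges n"
  shows "distr (label_measure n) borel (\<lambda>u. u e) = uniform_measure lborel {0..1}"
proof -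
  have "distr (label_measure n) borel (\<lambda>u. u e) =
      distr (label_measure n) (uniform_measure lborel {0..1}) (\<lambda>u. u e)"
    by (rule distr_cong) auto
  also have "\<dots> = uniform_measure lborel {0..1}"
    unfolding label_measure_def using assms by (intro distr_PiM_component prob_space_uniform)
  finally show ?thesis .
qed

lemma indep_labels: "labels.indep_vars n (\<lambda>_. borel) (\<lambda>e u. u e) (nary_edges n)"
proof (cases "nary_edges n = {}")
  case True
  then show ?thesis
    by (simp add: labels.indep_vars_def labels.indep_sets_def)
next
  case False
  let ?E = "nary_edges n"
  have "distr (label_measure n) (Pi\<^sub>M ?E (\<lambda>_. borel)) (\<lambda>u. \<lambda>e\<in>?E. u e)
      = distr (label_measure n) (label_measure n) (\<lambda>u. u)"
    by (rule distr_cong) (auto simp only: sets_label_measure, auto simp: label_measure_def space_PiM)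
  also have "\<dots> = label_measure n"
    by simp
  also have "\<dots> = Pi\<^sub>M ?E (\<lambda>e. distr (label_measure n) borel (\<lambda>u. u e))"
    by (subst label_measure_def, rule PiM_cong) (simp_all add: distr_label)
  finally show ?thesis
    by (subst labels.indep_vars_iff_distr_eq_PiM'[OF False]) auto
qed

lemma distr_subtree_labels:
  assumes "i < n"
  shows "distr (label_measure n) (label_measure n) (subtree_labels n i) = label_measure n"
  unfolding label_measure_def subtree_labels_def[abs_def]
  using assms by (intro distr_PiM_reindex prob_space_uniform) (auto simp: nary_edges_def)

text \<open>
  The children of the root, each with its label and its subtree, read disjoint sets of edges.
\<close>

lemma indep_root_subtrees:
  "labels.indep_vars n (\<lambda>i. borel \<Otimes>\<^sub>M label_measure n)
     (\<lambda>i u. (u [i], subtree_labels n i u)) {..<n}"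
proof -
  let ?E = "nary_edges n" and ?K = "\<lambda>i. (#) i ` nary_tree n"
  have "labels.indep_vars n (\<lambda>i. Pi\<^sub>M (?K i) (\<lambda>_. borel)) (\<lambda>i u. restrict (\<lambda>e. u e) (?K i)) {..<n}"
    by (rule labels.indep_vars_restrict[OF indep_labels]) (auto simp: disjoint_family_on_def)
  then have "labels.indep_vars n (\<lambda>i. borel \<Otimes>\<^sub>M label_measure n)
    (\<lambda>i u. (\<lambda>f. (f [i], subtree_labels n i f)) (restrict (\<lambda>e. u e) (?K i))) {..<n}"
  proof (rule labels.indep_vars_compose2)
    fix i assume i: "i \<in> {..<n}"
    have "(\<lambda>f. \<lambda>w\<in>?E. f (i # w)) \<in> Pi\<^sub>M (?K i) (\<lambda>_. borel) \<rightarrow>\<^sub>M (\<Pi>\<^sub>M e\<in>?E. (borel::real measure))"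
      using i by (intro measurable_restrict measurable_component_singleton) (auto simp: nary_edges_def)
    then have [measurable]: "subtree_labels n i \<in> Pi\<^sub>M (?K i) (\<lambda>_. borel) \<rightarrow>\<^sub>M label_measure n"
      by (simp add: subtree_labels_def[abs_def] cong: measurable_cong_sets[OF refl sets_label_measure])
    have [measurable]: "(\<lambda>f. f [i]) \<in> Pi\<^sub>M (?K i) (\<lambda>_. borel) \<rightarrow>\<^sub>M (borel::real measure)"
      using i by (intro measurable_component_singleton) auto
    show "(\<lambda>f. (f [i], subtree_labels n i f)) \<in> Pi\<^sub>M (?K i) (\<lambda>_. borel) \<rightarrow>\<^sub>M borel \<Otimes>\<^sub>M label_measure n"
      by measurable
  qed
  also have "(\<lambda>i u. (\<lambda>f. (f [i], subtree_labels n i f)) (restrict (\<lambda>e. u e) (?K i))) =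
      (\<lambda>i u. (u [i], subtree_labels n i u))"
    by (auto simp: fun_eq_iff subtree_labels_def nary_edges_def)
  finally show ?thesis .
qed

text \<open>
  Independence of a pair is a notion for two random variables of the same type, so the label of
  the child is first regarded as a function on a singleton.
\<close>

lemma distr_root_subtree:
  assumes i: "i < n"
  shows "distr (label_measure n) (borel \<Otimes>\<^sub>M label_measure n) (\<lambda>u. (u [i], subtree_labels n i u))
     = uniform_measure lborel {0..1} \<Otimes>\<^sub>M label_measure n"
proof -
  let ?E = "nary_edges n" and ?K = "(#) i ` nary_edges n"
  have "labels.indep_var n (Pi\<^sub>M {[i]} (\<lambda>_. borel)) (\<lambda>u. restrict (\<lambda>e. u e) {[i]})
      (Pi\<^sub>M ?K (\<lambda>_. borel)) (\<lambda>u. restrict (\<lambda>e. u e) ?K)"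
    using i by (intro labels.indep_var_restrict[OF indep_labels]) (auto simp: nary_edges_def)
  then have "labels.indep_var n (Pi\<^sub>M {[i]} (\<lambda>_. borel)) ((\<lambda>f. f) \<circ> (\<lambda>u. restrict (\<lambda>e. u e) {[i]}))
      (label_measure n) (subtree_labels n i \<circ> (\<lambda>u. restrict (\<lambda>e. u e) ?K))"
  proof (rule labels.indep_var_compose)
    have "(\<lambda>f. \<lambda>w\<in>?E. f (i # w)) \<in> Pi\<^sub>M ?K (\<lambda>_. borel) \<rightarrow>\<^sub>M (\<Pi>\<^sub>M e\<in>?E. (borel::real measure))"
      by (intro measurable_restrict measurable_component_singleton) auto
    then show "subtree_labels n i \<in> Pi\<^sub>M ?K (\<lambda>_. borel) \<rightarrow>\<^sub>M label_measure n"
      by (simp add: subtree_labels_def[abs_def] cong: measurable_cong_sets[OF refl sets_label_measure])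
  qed auto
  also have "subtree_labels n i \<circ> (\<lambda>u. restrict (\<lambda>e. u e) ?K) = subtree_labels n i"
    by (auto simp: fun_eq_iff subtree_labels_def)
  also have "(\<lambda>f. f) \<circ> (\<lambda>u. restrict (\<lambda>e. u e) {[i]}) = (\<lambda>u. restrict (\<lambda>e. u e) {[i]})"
    by auto
  finally have ind: "labels.indep_var n (Pi\<^sub>M {[i]} (\<lambda>_. borel)) (\<lambda>u. restrict u {[i]})
      (label_measure n) (subtree_labels n i)" .
  then have X [measurable]: "(\<lambda>u. restrict u {[i]}) \<in> label_measure n \<rightarrow>\<^sub>M Pi\<^sub>M {[i]} (\<lambda>_. borel)"
    by (simp add: labels.indep_var_distribution_eq)
  have c [measurable]: "(\<lambda>f. f [i]) \<in> Pi\<^sub>M {[i]} (\<lambda>_. borel) \<rightarrow>\<^sub>M (borel::real measure)"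
    by (intro measurable_component_singleton) auto
  let ?L = "label_measure n" and ?S = "Pi\<^sub>M {[i]} (\<lambda>_. borel::real measure)"
  have "distr ?L (borel \<Otimes>\<^sub>M ?L) (\<lambda>u. (u [i], subtree_labels n i u))
      = distr (distr ?L (?S \<Otimes>\<^sub>M ?L) (\<lambda>u. (restrict u {[i]}, subtree_labels n i u)))
         (borel \<Otimes>\<^sub>M ?L) (\<lambda>(f, g). (f [i], g))"
    using i by (subst distr_distr) (auto simp: comp_def)
  also have "\<dots> = distr (distr ?L ?S (\<lambda>u. restrict u {[i]}) \<Otimes>\<^sub>M ?L) (borel \<Otimes>\<^sub>M ?L) (\<lambda>(f, g). (f [i], g))"
    using ind i by (simp add: labels.indep_var_distribution_eq distr_subtree_labels)
  also have "\<dots> = distr (distr ?L ?S (\<lambda>u. restrict u {[i]})) borel (\<lambda>f. f [i]) \<Otimes>\<^sub>M distr ?L ?L (\<lambda>g. g)"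
    by (rule pair_measure_distr[symmetric]) (auto intro: labels.sigma_finite_measure)
  also have "\<dots> = uniform_measure lborel {0..1} \<Otimes>\<^sub>M ?L"
    using i by (simp add: distr_distr comp_def distr_label)
  finally show ?thesis .
qed

text \<open>
  One step of the branching recursion: expectations over the subtree at a child are expectations
  over a fresh temporal tree, averaged over a uniform root label.
\<close>

lemma nn_integral_root_subtree:
  assumes i: "i < n" and x: "0 \<le> x" "x \<le> 1"
    and F [measurable]: "(\<lambda>(y, u). F y u) \<in> borel_measurable (borel \<Otimes>\<^sub>M label_measure n)"
  shows "(\<integral>\<^sup>+u. (if u [i] < x then F (u [i]) (subtree_labels n i u) else 0) \<partial>label_measure n)
    = (\<integral>\<^sup>+y\<in>{0..<x}. (\<integral>\<^sup>+u. F y u \<partial>label_measure n) \<partial>lborel)"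
proof -
  let ?G = "\<lambda>z. if fst z < x then (case z of (y, u) \<Rightarrow> F y u) else 0"
  have [measurable]: "?G \<in> borel_measurable (uniform_measure lborel {0..1} \<Otimes>\<^sub>M label_measure n)"
    by measurable
  have "(\<integral>\<^sup>+u. (if u [i] < x then F (u [i]) (subtree_labels n i u) else 0) \<partial>label_measure n)
     = (\<integral>\<^sup>+z. ?G z \<partial>distr (label_measure n) (borel \<Otimes>\<^sub>M label_measure n)
          (\<lambda>u. (u [i], subtree_labels n i u)))"
    using i by (subst nn_integral_distr) auto
  also have "\<dots> = (\<integral>\<^sup>+y. \<integral>\<^sup>+u. ?G (y, u) \<partial>label_measure n \<partial>uniform_measure lborel {0..1})"
    unfolding distr_root_subtree[OF i] by (rule labels.nn_integral_fst[symmetric]) measurable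
  also have "\<dots> = (\<integral>\<^sup>+y. (\<integral>\<^sup>+u. ?G (y, u) \<partial>label_measure n) * indicator {0..1} y \<partial>lborel)"
    by (subst nn_integral_uniform_measure) (auto simp: divide_ennreal_def)
  also have "\<dots> = (\<integral>\<^sup>+y\<in>{0..<x}. (\<integral>\<^sup>+u. F y u \<partial>label_measure n) \<partial>lborel)"
    using x by (intro nn_integral_cong) (auto split: split_indicator)
  finally show ?thesis .
qed

section \<open>First moments\<close>

lemma nn_integral_FTC_Ico:
  fixes f F :: "real \<Rightarrow> real"
  assumes "f \<in> borel_measurable borel"
    and "\<And>y. y \<in> {a..b} \<Longrightarrow> (F has_real_derivative f y) (at y)"
    and "\<And>y. y \<in> {a..b} \<Longrightarrow> 0 \<le> f y" and "a \<le> b"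
  shows "(\<integral>\<^sup>+y\<in>{a..<b}. ennreal (f y) \<partial>lborel) = ennreal (F b - F a)"
proof -
  have "(\<integral>\<^sup>+y\<in>{a..<b}. ennreal (f y) \<partial>lborel) = (\<integral>\<^sup>+y. ennreal (f y) * indicator {a..b} y \<partial>lborel)"
    by (intro nn_integral_cong_AE eventually_mono[OF AE_lborel_singleton[of b]])
      (auto split: split_indicator)
  then show ?thesis
    using nn_integral_FTC_Icc[OF assms(1), of a b F, OF assms(2-4)] by simp
qed

lemma nn_integral_power_Ico:
  assumes "0 \<le> (x::real)"
  shows "(\<integral>\<^sup>+y\<in>{0..<x}. ennreal (y ^ k / fact k) \<partial>lborel) = ennreal (x ^ Suc k / fact (Suc k))"
proof -
  have "((\<lambda>y. y ^ Suc k / fact (Suc k)) has_real_derivative y ^ k / fact k) (at y)" for y :: real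
  proof -
    have "real (Suc k) * y ^ k / fact (Suc k) = y ^ k / fact k"
      by (simp add: field_simps del: of_nat_Suc)
    then show ?thesis
      using DERIV_cdivide[OF DERIV_pow[of "Suc k" y UNIV], of "fact (Suc k)"]
      by (simp only: diff_Suc_Suc diff_zero)
  qed
  then show ?thesis
    using assms nn_integral_FTC_Ico[of "\<lambda>y. y ^ k / fact k" 0 x "\<lambda>y. y ^ Suc k / fact (Suc k)"]
    by simp
qed

text \<open>
  A vertex at depth \<open>k\<close> is kept when \<open>k\<close> independent uniform labels all lie below \<open>x\<close> and come
  in one particular order, which gives \<open>x^k / k!\<close>.  The recursion integrates this one label at a
  time.
\<close>

lemma emeasure_mem_temporal_tree:
  assumes "v \<in> nary_tree n" "0 \<le> x" "x \<le> 1"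
  shows "emeasure (label_measure n) {u \<in> space (label_measure n). v \<in> temporal_tree n x u}
    = ennreal (x ^ length v / fact (length v))"
  using assms
proof (induction v arbitrary: x)
  case Nil
  then show ?case by (simp add: labels.emeasure_space_1)
next
  case (Cons i w)
  let ?L = "label_measure n"
  from Cons.prems have i: "i < n" and w [measurable]: "w \<in> nary_tree n"
    by auto
  have m [measurable]: "(\<lambda>(y, u). indicator {u \<in> space ?L. w \<in> temporal_tree n y u} u :: ennreal)
      \<in> borel_measurable (borel \<Otimes>\<^sub>M ?L)"
    by measurable
  have "emeasure ?L {u \<in> space ?L. i # w \<in> temporal_tree n x u}
      = (\<integral>\<^sup>+u. indicator {u \<in> space ?L. i # w \<in> temporal_tree n x u} u \<partial>?L)"
    using Cons.prems(1) by (subst nn_integral_indicator) auto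
  also have "\<dots> = (\<integral>\<^sup>+u. (if u [i] < x then
       indicator {u' \<in> space ?L. w \<in> temporal_tree n (u [i]) u'} (subtree_labels n i u) else 0) \<partial>?L)"
    using i measurable_space[OF measurable_subtree_labels[OF i]]
    by (intro nn_integral_cong) (auto simp: Cons_in_temporal_tree split: split_indicator)
  also have "\<dots> = (\<integral>\<^sup>+y\<in>{0..<x}.
      (\<integral>\<^sup>+u. indicator {u \<in> space ?L. w \<in> temporal_tree n y u} u \<partial>?L) \<partial>lborel)"
    by (rule nn_integral_root_subtree[OF i Cons.prems(2,3) m])
  also have "\<dots> = (\<integral>\<^sup>+y\<in>{0..<x}. ennreal (y ^ length w / fact (length w)) \<partial>lborel)"
    using Cons.prems w Cons.IH by (intro nn_integral_cong) (auto split: split_indicator)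
  finally show ?case
    using Cons.prems by (simp add: nn_integral_power_Ico del: fact_Suc power_Suc)
qed

definition level :: "nat \<Rightarrow> 'b list set \<Rightarrow> 'b list set" where
  "level k S = {v \<in> S. length v = k}"

lemma finite_level: "S \<subseteq> nary_tree n \<Longrightarrow> finite (level k S)"
  by (rule finite_subset[OF _ finite_nary_tree_level[of n k]]) (auto simp: level_def)

lemma card_level_temporal_tree:
  "real (card (level k (temporal_tree n x u)))
     = (\<Sum>v\<in>level k (nary_tree n). indicator (temporal_tree n x u) v)"
proof -
  have "level k (nary_tree n) \<inter> temporal_tree n x u = level k (temporal_tree n x u)"
    using temporal_tree_subset by (auto simp: level_def)
  then show ?thesis
    by (simp add: indicator_def sum.If_cases finite_level[of _ n])
qed

lemma measurable_card_level [measurable (raw)]: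
  assumes [measurable]: "f \<in> borel_measurable N" "g \<in> N \<rightarrow>\<^sub>M label_measure n"
  shows "(\<lambda>z. real (card (level k (temporal_tree n (f z) (g z))))) \<in> borel_measurable N"
proof -
  have [measurable]: "(\<lambda>z. indicator (temporal_tree n (f z) (g z)) v :: real) \<in> borel_measurable N"
    if "v \<in> level k (nary_tree n)" for v
  proof -
    have [measurable]: "v \<in> nary_tree n"
      using that by (simp add: level_def)
    show ?thesis
      unfolding indicator_def by measurable
  qed
  show ?thesis
    unfolding card_level_temporal_tree by measurable
qed

lemma nn_integral_card_level:
  assumes x: "0 \<le> x" "x \<le> 1"
  shows "(\<integral>\<^sup>+u. ennreal (card (level k (temporal_tree n x u))) \<partial>label_measure n)
    = ennreal ((real n * x) ^ k / fact k)"
proof -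
  let ?L = "label_measure n"
  have v: "(\<integral>\<^sup>+u. ennreal (indicator (temporal_tree n x u) v) \<partial>?L) = ennreal (x ^ k / fact k)"
    and m: "(\<lambda>u. ennreal (indicator (temporal_tree n x u) v)) \<in> borel_measurable ?L"
    if "v \<in> level k (nary_tree n)" for v
  proof -
    from that have v [measurable]: "v \<in> nary_tree n" and k: "length v = k"
      by (auto simp: level_def)
    have "(\<integral>\<^sup>+u. ennreal (indicator (temporal_tree n x u) v) \<partial>?L)
       = (\<integral>\<^sup>+u. indicator {u \<in> space ?L. v \<in> temporal_tree n x u} u \<partial>?L)"
      by (intro nn_integral_cong) (auto split: split_indicator)
    also have "\<dots> = emeasure ?L {u \<in> space ?L. v \<in> temporal_tree n x u}"
      by (rule nn_integral_indicator) measurable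
    finally show "(\<integral>\<^sup>+u. ennreal (indicator (temporal_tree n x u) v) \<partial>?L) = ennreal (x ^ k / fact k)"
      using emeasure_mem_temporal_tree[OF v x] k by simp
    show "(\<lambda>u. ennreal (indicator (temporal_tree n x u) v)) \<in> borel_measurable ?L"
      unfolding indicator_def by measurable
  qed
  have "(\<integral>\<^sup>+u. ennreal (card (level k (temporal_tree n x u))) \<partial>?L)
      = (\<integral>\<^sup>+u. (\<Sum>v\<in>level k (nary_tree n). ennreal (indicator (temporal_tree n x u) v)) \<partial>?L)"
    by (intro nn_integral_cong, subst card_level_temporal_tree, subst sum_ennreal) auto
  also have "\<dots> = (\<Sum>v\<in>level k (nary_tree n). ennreal (x ^ k / fact k))"
    by (subst nn_integral_sum[OF m]) (auto simp: v)
  also have "\<dots> = ennreal (real n ^ k) * ennreal (x ^ k / fact k)"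
    by (simp add: card_nary_tree_level level_def ennreal_of_nat_eq_real_of_nat)
  finally show ?thesis
    using x by (simp add: power_mult_distrib flip: ennreal_mult)
qed

text \<open>
  The generating function of the depth profile.  For \<open>s = 1\<close> it is the number of vertices; other
  values of \<open>s\<close> tilt the profile and serve for Chernoff bounds.  Its values are extended reals so
  that it is meaningful before the tree is known to be finite.
\<close>

definition tree_weight :: "real \<Rightarrow> 'b list set \<Rightarrow> ennreal" where
  "tree_weight s S = (\<Sum>k. ennreal (s ^ k * card (level k S)))"

lemma measurable_tree_weight [measurable]:
  "(\<lambda>u. tree_weight s (temporal_tree n x u)) \<in> borel_measurable (label_measure n)"
  unfolding tree_weight_def by measurable

text \<open>
  Level \<open>k\<close> has \<open>n^k\<close> candidates, so the expected profile is \<open>(n x)^k / k!\<close>: up to the factor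
  \<open>exp (n x)\<close> it is the Poisson distribution with mean \<open>n x\<close>.
\<close>

lemma nn_integral_tree_weight:
  assumes x: "0 \<le> x" "x \<le> 1" and s: "0 \<le> s"
  shows "(\<integral>\<^sup>+u. tree_weight s (temporal_tree n x u) \<partial>label_measure n) = ennreal (exp (s * (real n * x)))"
proof -
  have e: "(\<lambda>k. (s * (real n * x)) ^ k / fact k) sums exp (s * (real n * x))"
    using exp_converges[of "s * (real n * x)"] by (simp add: divide_inverse mult.commute)
  have "(\<integral>\<^sup>+u. tree_weight s (temporal_tree n x u) \<partial>label_measure n)
     = (\<Sum>k. \<integral>\<^sup>+u. ennreal (s ^ k * card (level k (temporal_tree n x u))) \<partial>label_measure n)"
    unfolding tree_weight_def by (rule nn_integral_suminf) measurable
  also have "\<dots> = (\<Sum>k. ennreal ((s * (real n * x)) ^ k / fact k))"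
  proof (rule arg_cong[where f = suminf], rule ext)
    fix k
    have "(\<integral>\<^sup>+u. ennreal (s ^ k * card (level k (temporal_tree n x u))) \<partial>label_measure n)
      = ennreal (s ^ k) * (\<integral>\<^sup>+u. ennreal (card (level k (temporal_tree n x u))) \<partial>label_measure n)"
      using s by (subst nn_integral_cmult[symmetric]) (auto simp: ennreal_mult)
    also have "\<dots> = ennreal (s ^ k * ((real n * x) ^ k / fact k))"
      using s x by (simp add: nn_integral_card_level ennreal_mult[symmetric])
    finally show "(\<integral>\<^sup>+u. ennreal (s ^ k * card (level k (temporal_tree n x u))) \<partial>label_measure n)
      = ennreal ((s * (real n * x)) ^ k / fact k)"
      by (simp add: power_mult_distrib)
  qed
  also have "\<dots> = ennreal (\<Sum>k. (s * (real n * x)) ^ k / fact k)"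
    using s x e by (intro suminf_ennreal2) (auto simp: sums_iff)
  also have "(\<Sum>k. (s * (real n * x)) ^ k / fact k) = exp (s * (real n * x))"
    using e by (simp add: sums_iff)
  finally show ?thesis .
qed

lemma tree_weight_upper_tail:
  assumes "0 \<le> x" "x \<le> 1" "0 \<le> s"
  shows "measure (label_measure n)
      {u \<in> space (label_measure n). tree_weight s (temporal_tree n x u) > ennreal (exp a)}
    \<le> exp (s * (real n * x) - a)"
proof -
  let ?L = "label_measure n" and ?W = "\<lambda>u. tree_weight s (temporal_tree n x u)"
  have "emeasure ?L {u \<in> space ?L. ?W u > ennreal (exp a)}
     \<le> emeasure ?L {u \<in> space ?L. 1 \<le> ennreal (exp (- a)) * ?W u}"
  proof (rule emeasure_mono)
    have "1 \<le> ennreal (exp (- a)) * w" if "ennreal (exp a) < w" for w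
    proof -
      have "1 = ennreal (exp (- a)) * ennreal (exp a)"
        by (simp add: exp_minus flip: ennreal_mult)
      also have "\<dots> \<le> ennreal (exp (- a)) * w"
        using that by (intro mult_left_mono) auto
      finally show ?thesis .
    qed
    then show "{u \<in> space ?L. ?W u > ennreal (exp a)} \<subseteq> {u \<in> space ?L. 1 \<le> ennreal (exp (- a)) * ?W u}"
      by auto
  qed measurable
  also have "\<dots> \<le> ennreal (exp (- a)) * (\<integral>\<^sup>+u. ?W u * indicator (space ?L) u \<partial>?L)"
    using nn_integral_Markov_inequality[of ?W "space ?L" ?L "ennreal (exp (- a))"] by simp
  also have "(\<integral>\<^sup>+u. ?W u * indicator (space ?L) u \<partial>?L) = (\<integral>\<^sup>+u. ?W u \<partial>?L)"
    by (intro nn_integral_cong) simp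
  also have "\<dots> = ennreal (exp (s * (real n * x)))"
    by (rule nn_integral_tree_weight[OF assms])
  also have "ennreal (exp (- a)) * \<dots> = ennreal (exp (s * (real n * x) - a))"
    by (simp add: exp_minus exp_diff field_simps flip: ennreal_mult)
  finally show ?thesis
    by (simp add: labels.emeasure_eq_measure)
qed

lemma sum_power_le_tree_weight:
  assumes S: "S \<subseteq> nary_tree n" and F: "finite F" "F \<subseteq> S" and s: "0 \<le> s"
  shows "ennreal (\<Sum>v\<in>F. s ^ length v) \<le> tree_weight s S"
proof -
  obtain m where m: "\<And>v. v \<in> F \<Longrightarrow> length v < m"
    using finite_imageI[OF F(1), of length] by (auto simp: finite_nat_set_iff_bounded)
  have "(\<Sum>v\<in>F. s ^ length v) = (\<Sum>k<m. \<Sum>v\<in>{v \<in> F. length v = k}. s ^ length v)"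
    using F(1) m by (intro sum.group[symmetric]) auto
  also have "\<dots> = (\<Sum>k<m. s ^ k * card (level k F))"
    by (intro sum.cong) (auto simp: level_def)
  also have "\<dots> \<le> (\<Sum>k<m. s ^ k * card (level k S))"
  proof -
    have "card (level k F) \<le> card (level k S)" for k
      using F S by (intro card_mono finite_level) (auto simp: level_def)
    then show ?thesis
      using s by (intro sum_mono mult_left_mono) auto
  qed
  finally have "ennreal (\<Sum>v\<in>F. s ^ length v) \<le> ennreal (\<Sum>k<m. s ^ k * card (level k S))"
    by (rule ennreal_leI)
  also have "\<dots> = (\<Sum>k<m. ennreal (s ^ k * card (level k S)))"
    using s by (simp add: sum_ennreal)
  also have "\<dots> \<le> tree_weight s S"
    unfolding tree_weight_def by (rule sum_le_suminf) auto
  finally show ?thesis .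
qed

text \<open>
  Finiteness of the tree is a consequence of the bound: finite subsets of bounded size cannot
  exhaust an infinite set.
\<close>

lemma tree_weight_1_bound:
  assumes S: "S \<subseteq> nary_tree n" and a: "tree_weight 1 S \<le> ennreal a" "0 \<le> a"
  shows "finite S" "real (card S) \<le> a"
proof -
  have bd: "real (card F) \<le> a" if "finite F" "F \<subseteq> S" for F
  proof -
    have "ennreal (real (card F)) \<le> ennreal a"
      using sum_power_le_tree_weight[OF S that, of 1] a(1) by simp
    then show ?thesis
      using a(2) by simp
  qed
  then have "card F \<le> nat \<lfloor>a\<rfloor>" if "finite F" "F \<subseteq> S" for F
    using that by (simp add: le_nat_floor)
  then show "finite S"
    using finite_if_finite_subsets_card_bdd[of S "nat \<lfloor>a\<rfloor>"] by auto
  then show "real (card S) \<le> a"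
    using bd by simp
qed

section \<open>Second moments and the lower tail of the size\<close>

text \<open>
  The variance of a sum of independent variables is the sum of the variances, and each variance
  is at most the second moment.
\<close>

lemma (in prob_space) expectation_square_sum_indep_le:
  fixes X :: "'i \<Rightarrow> 'a \<Rightarrow> real"
  assumes I: "finite I" and ind: "indep_vars (\<lambda>_. borel) X I"
    and bd: "\<And>i \<omega>. i \<in> I \<Longrightarrow> \<omega> \<in> space M \<Longrightarrow> \<bar>X i \<omega>\<bar> \<le> B"
  shows "expectation (\<lambda>\<omega>. (c + (\<Sum>i\<in>I. X i \<omega>))\<^sup>2)
    \<le> (c + (\<Sum>i\<in>I. expectation (X i)))\<^sup>2 + (\<Sum>i\<in>I. expectation (\<lambda>\<omega>. (X i \<omega>)\<^sup>2))"
proof -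
  have [measurable]: "X i \<in> borel_measurable M" if "i \<in> I" for i
    using ind that by (simp add: indep_vars_def)
  have int1 [simp]: "integrable M (X i)" if "i \<in> I" for i
    using that bd by (intro integrable_const_bound[of _ B]) auto
  have int2 [simp]: "integrable M (\<lambda>\<omega>. X i \<omega> * X j \<omega>)" if "i \<in> I" "j \<in> I" for i j
    using that bd by (intro integrable_const_bound[of _ "B * B"] AE_I2)
      (auto simp: abs_mult intro!: mult_mono order_trans[OF abs_ge_zero bd])
  have mult: "expectation (\<lambda>\<omega>. X i \<omega> * X j \<omega>) = expectation (X i) * expectation (X j)"
    if "i \<in> I" "j \<in> I" "i \<noteq> j" for i j
  proof -
    have "integrable M (X l)" if "l \<in> {i, j}" for l
      using that \<open>i \<in> I\<close> \<open>j \<in> I\<close> by auto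
    then show ?thesis
      using indep_vars_lebesgue_integral[of "{i, j}" X] indep_vars_subset[OF ind, of "{i, j}"] that
      by simp
  qed
  have pair: "expectation (\<lambda>\<omega>. X i \<omega> * X j \<omega>) \<le> expectation (X i) * expectation (X j)
      + (if i = j then expectation (\<lambda>\<omega>. (X i \<omega>)\<^sup>2) else 0)" if "i \<in> I" "j \<in> I" for i j
    using mult[OF that] by (auto simp: power2_eq_square)
  have "expectation (\<lambda>\<omega>. (c + (\<Sum>i\<in>I. X i \<omega>))\<^sup>2)
     = expectation (\<lambda>\<omega>. c\<^sup>2 + 2 * c * (\<Sum>i\<in>I. X i \<omega>) + (\<Sum>i\<in>I. \<Sum>j\<in>I. X i \<omega> * X j \<omega>))"
    by (intro Bochner_Integration.integral_cong refl)
      (simp add: power2_sum power2_eq_square[of "sum _ _"] sum_product)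
  also have "\<dots> = c\<^sup>2 + 2 * c * (\<Sum>i\<in>I. expectation (X i))
      + (\<Sum>i\<in>I. \<Sum>j\<in>I. expectation (\<lambda>\<omega>. X i \<omega> * X j \<omega>))"
    by (simp add: prob_space)
  also have "\<dots> \<le> c\<^sup>2 + 2 * c * (\<Sum>i\<in>I. expectation (X i))
      + (\<Sum>i\<in>I. \<Sum>j\<in>I. expectation (X i) * expectation (X j)
          + (if i = j then expectation (\<lambda>\<omega>. (X i \<omega>)\<^sup>2) else 0))"
    by (intro add_left_mono sum_mono pair)
  also have "\<dots> = (c + (\<Sum>i\<in>I. expectation (X i)))\<^sup>2 + (\<Sum>i\<in>I. expectation (\<lambda>\<omega>. (X i \<omega>)\<^sup>2))"
    using I by (simp add: sum.distrib power2_sum power2_eq_square[of "sum _ _"] sum_product)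
  finally show ?thesis .
qed

text \<open>
  A Paley-Zygmund bound.  The constants come from splitting \<open>Z\<close> at \<open>\<mu> / 2\<close> and bounding the large
  part by \<open>z \<le> z\<^sup>2 / (8 * \<mu>) + 2 * \<mu>\<close>, the arithmetic-geometric mean inequality, whose
  two terms are balanced when the second moment is of order \<open>\<mu>\<^sup>2\<close>.
\<close>

lemma (in prob_space) prob_ge_half_of_second_moment:
  fixes Z :: "'a \<Rightarrow> real"
  assumes [simp]: "integrable M Z" "integrable M (\<lambda>\<omega>. (Z \<omega>)\<^sup>2)"
    and \<mu>: "0 < \<mu>" "7 / 8 * \<mu> \<le> expectation Z" "expectation (\<lambda>\<omega>. (Z \<omega>)\<^sup>2) \<le> 2 * \<mu>\<^sup>2"
  shows "1 / 16 \<le> prob {\<omega> \<in> space M. \<mu> / 2 \<le> Z \<omega>}"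
proof -
  define A where "A = {\<omega> \<in> space M. \<mu> / 2 \<le> Z \<omega>}"
  have [measurable]: "Z \<in> borel_measurable M"
    using assms(1) by (rule borel_measurable_integrable)
  have [simp]: "A \<in> events"
    unfolding A_def by measurable
  have "z \<le> \<mu> / 2 + z\<^sup>2 / (8 * \<mu>) + 2 * \<mu> * of_bool (\<mu> / 2 \<le> z)" for z
  proof -
    have "0 \<le> (z - 4 * \<mu>)\<^sup>2 / (8 * \<mu>)"
      using \<mu>(1) by simp
    also have "\<dots> = z\<^sup>2 / (8 * \<mu>) + 2 * \<mu> - z"
      using \<mu>(1) by (simp add: field_simps power2_eq_square)
    finally show ?thesis
      using \<mu>(1) by (auto simp: not_le add_increasing2)
  qed
  then have "Z \<omega> \<le> \<mu> / 2 + (Z \<omega>)\<^sup>2 / (8 * \<mu>) + 2 * \<mu> * indicator A \<omega>" if "\<omega> \<in> space M" for \<omega>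
    using that by (simp add: A_def indicator_def of_bool_def)
  then have "expectation Z
      \<le> expectation (\<lambda>\<omega>. \<mu> / 2 + (Z \<omega>)\<^sup>2 / (8 * \<mu>) + 2 * \<mu> * indicator A \<omega>)"
    by (intro integral_mono Bochner_Integration.integrable_add integrable_mult_right
        integrable_divide integrable_real_indicator) (auto simp: emeasure_eq_measure)
  also have "\<dots> = \<mu> / 2 + expectation (\<lambda>\<omega>. (Z \<omega>)\<^sup>2) / (8 * \<mu>) + 2 * \<mu> * prob A"
    by (simp add: prob_space emeasure_eq_measure)
  also have "\<dots> \<le> \<mu> / 2 + 2 * \<mu>\<^sup>2 / (8 * \<mu>) + 2 * \<mu> * prob A"
    using \<mu> by (intro add_mono divide_right_mono) auto
  also have "\<dots> = \<mu> * (3 / 4 + 2 * prob A)"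
    using \<mu>(1) by (simp add: field_simps power2_eq_square)
  finally have "\<mu> * (7 / 8) \<le> \<mu> * (3 / 4 + 2 * prob A)"
    using \<mu>(2) by simp
  then show ?thesis
    unfolding A_def[symmetric] using \<mu>(1) by (simp add: mult_le_cancel_left_pos)
qed

text \<open>
  The number of vertices of depth at most \<open>k\<close>.  Truncation makes the second moment bounded and
  allows induction on \<open>k\<close>.
\<close>

definition trunc_size :: "nat \<Rightarrow> nat \<Rightarrow> real \<Rightarrow> (nat list \<Rightarrow> real) \<Rightarrow> real" where
  "trunc_size n k x u = (\<Sum>j\<le>k. real (card (level j (temporal_tree n x u))))"

lemma measurable_trunc_size [measurable (raw)]:
  "f \<in> borel_measurable N \<Longrightarrow> g \<in> N \<rightarrow>\<^sub>M label_measure n \<Longrightarrow>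
    (\<lambda>z. trunc_size n k (f z) (g z)) \<in> borel_measurable N"
  unfolding trunc_size_def by (intro borel_measurable_sum measurable_card_level)

lemma trunc_size_nonneg: "0 \<le> trunc_size n k x u"
  by (simp add: trunc_size_def sum_nonneg)

lemma trunc_size_le: "trunc_size n k x u \<le> (\<Sum>j\<le>k. real n ^ j)"
  unfolding trunc_size_def
proof (rule sum_mono)
  fix j
  have "card (level j (temporal_tree n x u)) \<le> card {v \<in> nary_tree n. length v = j}"
    using temporal_tree_subset by (intro card_mono finite_nary_tree_level) (auto simp: level_def)
  then show "real (card (level j (temporal_tree n x u))) \<le> real n ^ j"
    by (simp add: card_nary_tree_level flip: of_nat_power)
qed

lemma integrable_trunc_size [simp]:
  "integrable (label_measure n) (trunc_size n k x)"
  "integrable (label_measure n) (\<lambda>u. (trunc_size n k x u)\<^sup>2)"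
proof -
  show "integrable (label_measure n) (trunc_size n k x)"
    using trunc_size_le trunc_size_nonneg
    by (intro labels.integrable_const_bound[of _ "\<Sum>j\<le>k. real n ^ j"]) auto
  show "integrable (label_measure n) (\<lambda>u. (trunc_size n k x u)\<^sup>2)"
    using trunc_size_le trunc_size_nonneg
    by (intro labels.integrable_const_bound[of _ "(\<Sum>j\<le>k. real n ^ j)\<^sup>2"]) (auto intro!: power_mono)
qed

lemma expectation_trunc_size:
  assumes x: "0 \<le> x" "x \<le> 1"
  shows "labels.expectation n (trunc_size n k x) = (\<Sum>j\<le>k. (real n * x) ^ j / fact j)"
proof -
  have "(\<integral>\<^sup>+u. ennreal (trunc_size n k x u) \<partial>label_measure n)
      = (\<Sum>j\<le>k. \<integral>\<^sup>+u. ennreal (card (level j (temporal_tree n x u))) \<partial>label_measure n)"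
    unfolding trunc_size_def by (subst nn_integral_sum[symmetric]) (auto simp: sum_ennreal)
  also have "\<dots> = ennreal (\<Sum>j\<le>k. (real n * x) ^ j / fact j)"
    using x by (simp add: nn_integral_card_level sum_ennreal)
  finally show ?thesis
    using x trunc_size_nonneg
    by (intro integral_eq_nn_integral[THEN trans]) (auto intro!: sum_nonneg enn2real_ennreal)
qed

lemma level_0_temporal_tree: "level 0 (temporal_tree n x u) = {[]}"
  by (auto simp: level_def)

lemma card_level_Suc_temporal_tree:
  "card (level (Suc j) (temporal_tree n x u)) =
     (\<Sum>i<n. if u [i] < x then card (level j (temporal_tree n (u [i]) (subtree_labels n i u))) else 0)"
proof -
  let ?B = "\<lambda>i. if u [i] < x then level j (temporal_tree n (u [i]) (subtree_labels n i u)) else {}"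
  have "level (Suc j) (temporal_tree n x u) = (\<Union>i<n. (#) i ` ?B i)"
    by (auto simp: level_def length_Suc_conv Cons_in_temporal_tree image_iff split: if_splits)
  then have "card (level (Suc j) (temporal_tree n x u)) = (\<Sum>i<n. card ((#) i ` ?B i))"
    by (simp only:, intro card_UN_disjoint)
      (auto intro: finite_level[OF temporal_tree_subset])
  also have "\<dots> = (\<Sum>i<n. card (?B i))"
    by (intro sum.cong refl card_image) auto
  finally show ?thesis
    by (simp add: if_distrib[of card] cong: if_cong)
qed

lemma trunc_size_Suc:
  "trunc_size n (Suc k) x u =
     1 + (\<Sum>i<n. if u [i] < x then trunc_size n k (u [i]) (subtree_labels n i u) else 0)"
proof -
  have "trunc_size n (Suc k) x u = 1 + (\<Sum>j\<le>k. real (card (level (Suc j) (temporal_tree n x u))))"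
    unfolding trunc_size_def by (subst sum.atMost_Suc_shift) (simp add: level_0_temporal_tree)
  also have "(\<Sum>j\<le>k. real (card (level (Suc j) (temporal_tree n x u)))) =
     (\<Sum>i<n. \<Sum>j\<le>k. if u [i] < x then
        real (card (level j (temporal_tree n (u [i]) (subtree_labels n i u)))) else 0)"
    unfolding card_level_Suc_temporal_tree of_nat_sum
    by (subst sum.swap) (intro sum.cong refl, simp)
  also have "\<dots> = (\<Sum>i<n. if u [i] < x then trunc_size n k (u [i]) (subtree_labels n i u) else 0)"
    by (intro sum.cong refl) (simp add: trunc_size_def)
  finally show ?thesis .
qed

text \<open>
  Write \<open>m x\<close> for the second moment.  The subtrees at the children of the root are independent,
  so \<open>m x\<close> is at most the squared mean \<open>exp (2 * n * x)\<close> plus \<open>n\<close> times the integral of \<open>m\<close> from \<open>0\<close>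
  to \<open>x\<close>.  The right-hand side of the claim solves this integral equation with equality and is
  therefore reproduced in each step of the induction on the truncation depth.
\<close>

lemma second_moment_trunc_size:
  assumes "0 \<le> x" "x \<le> 1"
  shows "labels.expectation n (\<lambda>u. (trunc_size n k x u)\<^sup>2) \<le> 2 * exp (2 * real n * x) - exp (real n * x)"
  using assms
proof (induction k arbitrary: x)
  case 0
  have "1 \<le> exp (real n * x)"
    using 0 by simp
  moreover have "exp (2 * real n * x) = exp (real n * x) * exp (real n * x)"
    by (simp flip: exp_add)
  moreover have "exp (real n * x) * 1 \<le> exp (real n * x) * exp (real n * x)"
    using 0 by (intro mult_left_mono) auto
  ultimately have "1 \<le> 2 * exp (2 * real n * x) - exp (real n * x)"
    by linarith
  then show ?case
    by (simp add: trunc_size_def level_0_temporal_tree labels.prob_space)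
next
  case (Suc k)
  let ?L = "label_measure n" and ?b = "\<Sum>j\<le>k. real n ^ j"
  define X where "X i u = (if u [i] < x then trunc_size n k (u [i]) (subtree_labels n i u) else 0)"
    for i :: nat and u
  have ind: "labels.indep_vars n (\<lambda>_. borel) X {..<n}"
  proof -
    have "labels.indep_vars n (\<lambda>_. borel)
        (\<lambda>i u. (\<lambda>z. if fst z < x then trunc_size n k (fst z) (snd z) else 0)
          (u [i], subtree_labels n i u)) {..<n}"
      by (rule labels.indep_vars_compose2[OF indep_root_subtrees]) measurable
    then show ?thesis
      by (simp only: X_def[abs_def] fst_conv snd_conv)
  qed
  have X_bd: "0 \<le> X i u" "\<bar>X i u\<bar> \<le> ?b" for i u
    using trunc_size_le[of n k] trunc_size_nonneg[of n k] by (auto simp: X_def sum_nonneg)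
  have X_meas [measurable]: "X i \<in> borel_measurable ?L" if "i < n" for i
    using ind that by (simp add: labels.indep_vars_def)
  have X_sq: "labels.expectation n (\<lambda>u. (X i u)\<^sup>2)
     \<le> (exp (2 * real n * x) - exp (real n * x)) / real n" if i: "i < n" for i
  proof -
    have pos: "0 \<le> 2 * exp (2 * real n * y) - exp (real n * y)" if "0 \<le> y" for y
    proof -
      have "exp (real n * y) \<le> exp (2 * real n * y)"
        using that by (simp add: mult_right_mono)
      then show ?thesis
        using exp_ge_zero[of "2 * real n * y"] by linarith
    qed
    have "(\<integral>\<^sup>+u. ennreal ((X i u)\<^sup>2) \<partial>?L) = (\<integral>\<^sup>+u. (if u [i] < x then
         ennreal ((trunc_size n k (u [i]) (subtree_labels n i u))\<^sup>2) else 0) \<partial>?L)"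
      by (intro nn_integral_cong) (simp add: X_def)
    also have "\<dots> = (\<integral>\<^sup>+y\<in>{0..<x}. (\<integral>\<^sup>+u. ennreal ((trunc_size n k y u)\<^sup>2) \<partial>?L) \<partial>lborel)"
      by (rule nn_integral_root_subtree[OF i Suc.prems]) measurable
    also have "\<dots> \<le> (\<integral>\<^sup>+y\<in>{0..<x}. ennreal (2 * exp (2 * real n * y) - exp (real n * y)) \<partial>lborel)"
      using Suc.IH Suc.prems
      by (intro nn_integral_mono)
        (auto simp: nn_integral_eq_integral ennreal_leI split: split_indicator)
    also have "\<dots> = ennreal ((exp (2 * real n * x) / real n - exp (real n * x) / real n)
         - (exp (2 * real n * 0) / real n - exp (real n * 0) / real n))"
      using i Suc.prems pos
      by (intro nn_integral_FTC_Ico) (auto intro!: derivative_eq_intros)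
    finally have "(\<integral>\<^sup>+u. ennreal ((X i u)\<^sup>2) \<partial>?L) \<le> ennreal ((exp (2 * real n * x) - exp (real n * x)) / real n)"
      by (simp add: diff_divide_distrib)
    moreover have "integrable ?L (\<lambda>u. (X i u)\<^sup>2)"
      using i X_bd by (intro labels.integrable_const_bound[of _ "?b\<^sup>2"])
        (auto simp: power_abs[symmetric] intro!: power_mono)
    moreover have "0 \<le> (exp (2 * real n * x) - exp (real n * x)) / real n"
      using Suc.prems by (auto simp: mult_right_mono intro!: divide_nonneg_nonneg)
    ultimately show ?thesis
      by (subst (asm) nn_integral_eq_integral) auto
  qed
  have mean: "1 + (\<Sum>i<n. labels.expectation n (X i)) \<le> exp (real n * x)"
    and mean0: "0 \<le> 1 + (\<Sum>i<n. labels.expectation n (X i))"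
  proof -
    have int: "integrable ?L (X i)" if "i \<in> {..<n}" for i
      using that X_bd by (intro labels.integrable_const_bound[of _ ?b]) auto
    have "1 + (\<Sum>i<n. labels.expectation n (X i)) = labels.expectation n (\<lambda>u. 1 + (\<Sum>i<n. X i u))"
      using Bochner_Integration.integral_sum[of "{..<n}" ?L X, OF int]
        Bochner_Integration.integrable_sum[of "{..<n}" ?L X, OF int]
      by (subst Bochner_Integration.integral_add) (auto simp: labels.prob_space)
    also have "\<dots> = labels.expectation n (trunc_size n (Suc k) x)"
      by (intro Bochner_Integration.integral_cong refl) (simp add: trunc_size_Suc X_def)
    also have "\<dots> = (\<Sum>j\<le>Suc k. (real n * x) ^ j / fact j)"
      by (rule expectation_trunc_size[OF Suc.prems])
    also have "\<dots> \<le> exp (real n * x)"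
    proof -
      have e: "(\<lambda>j. (real n * x) ^ j / fact j) sums exp (real n * x)"
        using exp_converges[of "real n * x"] by (simp add: divide_inverse mult.commute)
      show ?thesis
        unfolding sums_unique[OF e] using Suc.prems
        by (intro sum_le_suminf sums_summable[OF e]) auto
    qed
    finally show "1 + (\<Sum>i<n. labels.expectation n (X i)) \<le> exp (real n * x)" .
    show "0 \<le> 1 + (\<Sum>i<n. labels.expectation n (X i))"
      using X_bd by (intro add_nonneg_nonneg sum_nonneg Bochner_Integration.integral_nonneg) auto
  qed
  have "labels.expectation n (\<lambda>u. (trunc_size n (Suc k) x u)\<^sup>2)
      = labels.expectation n (\<lambda>u. (1 + (\<Sum>i<n. X i u))\<^sup>2)"
    by (simp add: trunc_size_Suc X_def)
  also have "\<dots> \<le> (1 + (\<Sum>i<n. labels.expectation n (X i)))\<^sup>2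
      + (\<Sum>i<n. labels.expectation n (\<lambda>u. (X i u)\<^sup>2))"
    using X_bd by (intro labels.expectation_square_sum_indep_le[OF _ ind]) auto
  also have "\<dots> \<le> (exp (real n * x))\<^sup>2 + (\<Sum>i<n. (exp (2 * real n * x) - exp (real n * x)) / real n)"
    using mean mean0 X_sq by (intro add_mono power_mono sum_mono) auto
  also have "\<dots> \<le> exp (2 * real n * x) + (exp (2 * real n * x) - exp (real n * x))"
    using exp_double[of "real n * x"] by (cases "n = 0") (auto simp: mult.assoc)
  finally show ?case
    by simp
qed

text \<open>
  The truncated mean tends to \<open>exp (n * x)\<close>, so a deep enough truncation keeps the share \<open>7 / 8\<close>
  of it that the Paley-Zygmund bound asks for.
\<close>

lemma prob_trunc_size_large:
  assumes x: "0 \<le> x" "x \<le> 1"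
  obtains k where
    "1 / 16 \<le> labels.prob n {u \<in> space (label_measure n). exp (real n * x) / 2 \<le> trunc_size n k x u}"
proof -
  have "(\<lambda>j. (real n * x) ^ j / fact j) sums exp (real n * x)"
    using exp_converges[of "real n * x"] by (simp add: divide_inverse mult.commute)
  then have "(\<lambda>k. \<Sum>j\<le>k. (real n * x) ^ j / fact j) \<longlonglongrightarrow> exp (real n * x)"
    by (simp add: sums_def_le)
  then have "\<forall>\<^sub>F k in sequentially. 7 / 8 * exp (real n * x) < (\<Sum>j\<le>k. (real n * x) ^ j / fact j)"
    by (rule order_tendstoD) simp
  then obtain k where k: "7 / 8 * exp (real n * x) < (\<Sum>j\<le>k. (real n * x) ^ j / fact j)"
    by (auto simp: eventually_sequentially)
  have "2 * exp (2 * real n * x) - exp (real n * x) \<le> 2 * (exp (real n * x))\<^sup>2"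
    using exp_double[of "real n * x"] by (simp add: mult.assoc)
  then show thesis
    using k second_moment_trunc_size[OF x, of n k]
    by (intro that[of k] labels.prob_ge_half_of_second_moment)
      (auto simp: expectation_trunc_size[OF x])
qed

lemma trunc_size_le_card:
  assumes "finite (temporal_tree n x u)"
  shows "trunc_size n k x u \<le> card (temporal_tree n x u)"
proof -
  have "(\<Sum>j\<le>k. card (level j (temporal_tree n x u))) = card (\<Union>j\<le>k. level j (temporal_tree n x u))"
    using assms by (intro card_UN_disjoint[symmetric]) (auto simp: level_def)
  also have "\<dots> \<le> card (temporal_tree n x u)"
    using assms by (intro card_mono) (auto simp: level_def)
  finally show ?thesis
    by (simp add: trunc_size_def flip: of_nat_sum)
qed

lemma card_temporal_tree_ge_subtree:
  assumes fin: "finite (temporal_tree n x u)" and i: "i < n" and y: "y \<le> u [i]" "u [i] < x"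
  shows "trunc_size n k y (subtree_labels n i u) \<le> card (temporal_tree n x u)"
proof -
  let ?S = "temporal_tree n y (subtree_labels n i u)"
  have sub: "(#) i ` ?S \<subseteq> temporal_tree n x u"
    using temporal_tree_mono[OF y(1), of n "subtree_labels n i u"] i y
    by (auto simp: Cons_in_temporal_tree)
  then have "finite ?S"
    using fin by (metis finite_imageD finite_subset inj_on_Cons1)
  then have "trunc_size n k y (subtree_labels n i u) \<le> card ?S"
    by (rule trunc_size_le_card)
  also have "card ?S = card ((#) i ` ?S)"
    by (simp add: card_image)
  also have "\<dots> \<le> card (temporal_tree n x u)"
    by (rule card_mono[OF fin sub])
  finally show ?thesis
    by simp
qed

text \<open>
  The second moment shows only that the size is of the order of its mean with probability bounded
  away from \<open>0\<close>.  The \<open>n\<close> children of the root boost this to high probability: if the label of a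
  child lies in the interval from \<open>y\<close> to \<open>x\<close>, then the tree contains a copy of the temporal tree
  with root label \<open>y\<close> at that child, and this copy is independent of the label.  Each child thus
  succeeds with probability at least \<open>(x - y) / 16\<close>, independently of the others.
\<close>

lemma card_temporal_tree_lower_tail:
  assumes xy: "0 \<le> y" "y \<le> x" "x \<le> 1"
    and B: "B \<in> sets (label_measure n)" "\<And>u. u \<in> B \<Longrightarrow> finite (temporal_tree n x u)"
      "\<And>u. u \<in> B \<Longrightarrow> card (temporal_tree n x u) < exp (real n * y) / 2"
  shows "labels.prob n B \<le> (1 - (x - y) / 16) ^ n"
proof (cases "n = 0")
  case False
  let ?L = "label_measure n"
  obtain k where k: "1 / 16 \<le> labels.prob n {u \<in> space ?L. exp (real n * y) / 2 \<le> trunc_size n k y u}"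
    using prob_trunc_size_large[of y n] xy by auto
  let ?C = "{u \<in> space ?L. exp (real n * y) / 2 \<le> trunc_size n k y u}"
  have C [measurable]: "?C \<in> sets ?L"
    by measurable
  \<comment> \<open>The event, for one child, that its subtree alone makes the tree large.\<close>
  let ?A = "{y<..<x} \<times> ?C" and ?X = "\<lambda>i u. (u [i], subtree_labels n i u)"
  let ?Ac = "space (borel \<Otimes>\<^sub>M ?L) - ?A"
  have A [measurable]: "?A \<in> sets (borel \<Otimes>\<^sub>M ?L)"
    by measurable
  have pA: "labels.prob n (?X i -` ?Ac \<inter> space ?L) \<le> 1 - (x - y) / 16" if i: "i < n" for i
  proof -
    have X [measurable]: "?X i \<in> ?L \<rightarrow>\<^sub>M borel \<Otimes>\<^sub>M ?L"
      using i by (intro measurable_Pair measurable_label measurable_subtree_labels) auto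
    have "emeasure ?L (?X i -` ?A \<inter> space ?L) = emeasure (distr ?L (borel \<Otimes>\<^sub>M ?L) (?X i)) ?A"
      by (subst emeasure_distr) auto
    also have "\<dots> = emeasure (uniform_measure lborel {0..1}) {y<..<x} * emeasure ?L ?C"
      unfolding distr_root_subtree[OF i] by (rule labels.emeasure_pair_measure_Times) auto
    also have "emeasure (uniform_measure lborel {0..1}) {y<..<x} = ennreal (x - y)"
    proof -
      have "{0..1} \<inter> {y<..<x} = {y<..<x}"
        using xy by auto
      then show ?thesis
        using xy by (simp add: divide_ennreal_def)
    qed
    finally have "labels.prob n (?X i -` ?A \<inter> space ?L) = (x - y) * labels.prob n ?C"
      using xy by (simp add: labels.emeasure_eq_measure flip: ennreal_mult)
    moreover have "(x - y) * (1 / 16) \<le> (x - y) * labels.prob n ?C"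
      using k xy by (intro mult_left_mono) auto
    moreover have "?X i -` ?Ac \<inter> space ?L = space ?L - (?X i -` ?A \<inter> space ?L)"
      using measurable_space[OF X] by auto
    ultimately show ?thesis
      by (simp add: labels.prob_compl)
  qed
  have "B \<subseteq> (\<Inter>i\<in>{..<n}. ?X i -` ?Ac \<inter> space ?L)"
  proof
    fix u assume u: "u \<in> B"
    then have us: "u \<in> space ?L"
      using B(1) sets.sets_into_space by blast
    show "u \<in> (\<Inter>i\<in>{..<n}. ?X i -` ?Ac \<inter> space ?L)"
    proof (intro INT_I)
      fix i assume "i \<in> {..<n}"
      then have i: "i < n"
        by simp
      have "?X i u \<notin> ?A"
        using card_temporal_tree_ge_subtree[OF B(2)[OF u] i, of y k] B(3)[OF u] by auto
      moreover have "?X i u \<in> space (borel \<Otimes>\<^sub>M ?L)"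
        using us measurable_space[OF measurable_subtree_labels[OF i] us] by (simp add: space_pair_measure)
      ultimately show "u \<in> ?X i -` ?Ac \<inter> space ?L"
        using us by simp
    qed
  qed
  then have "labels.prob n B \<le> labels.prob n (\<Inter>i\<in>{..<n}. ?X i -` ?Ac \<inter> space ?L)"
  proof (rule labels.finite_measure_mono)
    show "(\<Inter>i\<in>{..<n}. ?X i -` ?Ac \<inter> space ?L) \<in> sets ?L"
      using False by (intro sets.finite_INT measurable_sets[where A = "borel \<Otimes>\<^sub>M ?L"]) auto
  qed
  also have "\<dots> = (\<Prod>i<n. labels.prob n (?X i -` ?Ac \<inter> space ?L))"
    using False by (intro labels.indep_varsD_finite[OF indep_root_subtrees]) auto
  also have "\<dots> \<le> (\<Prod>i<n. 1 - (x - y) / 16)"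
    using pA by (intro prod_mono) auto
  finally show ?thesis
    by simp
qed simp

section \<open>Size of the tree on the logarithmic scale\<close>

text \<open>
  The size is a measurable function of the labels because it is read off from the total weight,
  also for infinite trees: \<open>card\<close> is \<open>0\<close> there, and so is \<^const>\<open>enn2real\<close> of the infinite weight.
\<close>

lemma finite_temporal_tree_iff:
  "finite (temporal_tree n x u) \<longleftrightarrow> tree_weight 1 (temporal_tree n x u) < \<infinity>"
  and real_card_temporal_tree:
  "real (card (temporal_tree n x u)) = enn2real (tree_weight 1 (temporal_tree n x u))"
proof -
  let ?T = "temporal_tree n x u"
  have fin: "tree_weight 1 ?T = ennreal (card ?T)" if "finite ?T"
  proof -
    have "finite (length ` ?T)"
      using that by simp
    then obtain m where m: "\<And>v. v \<in> ?T \<Longrightarrow> length v < m"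
      by (auto simp: finite_nat_set_iff_bounded)
    have "tree_weight 1 ?T = (\<Sum>k<m. ennreal (card (level k ?T)))"
      unfolding tree_weight_def
      by (subst suminf_finite[of "{..<m}"]) (use m in \<open>auto simp: level_def card_eq_0_iff\<close>)
    also have "\<dots> = ennreal (\<Sum>k<m. \<Sum>v\<in>{v \<in> ?T. length v = k}. 1)"
      by (subst sum_ennreal) (auto simp: level_def)
    also have "(\<Sum>k<m. \<Sum>v\<in>{v \<in> ?T. length v = k}. 1::real) = (\<Sum>v\<in>?T. 1)"
      using that m by (intro sum.group) auto
    finally show ?thesis
      by simp
  qed
  have inf: "tree_weight 1 ?T = \<infinity>" if "infinite ?T"
  proof (rule ccontr)
    assume "tree_weight 1 ?T \<noteq> \<infinity>"
    then have "tree_weight 1 ?T \<le> ennreal (enn2real (tree_weight 1 ?T))"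
      by (simp add: less_top)
    then show False
      using tree_weight_1_bound(1)[OF temporal_tree_subset] that by (metis enn2real_nonneg)
  qed
  show "finite ?T \<longleftrightarrow> tree_weight 1 ?T < \<infinity>"
    using fin inf by (cases "finite ?T") auto
  show "real (card ?T) = enn2real (tree_weight 1 ?T)"
    using fin inf by (cases "finite ?T") auto
qed

lemma measurable_finite_temporal_tree [measurable]:
  "Measurable.pred (label_measure n) (\<lambda>u. finite (temporal_tree n x u))"
  unfolding finite_temporal_tree_iff by measurable

lemma measurable_card_temporal_tree [measurable]:
  "(\<lambda>u. real (card (temporal_tree n x u))) \<in> borel_measurable (label_measure n)"
  unfolding real_card_temporal_tree by measurable

lemma measurable_temporal_tree_eq:
  "Measurable.pred (label_measure n) (\<lambda>u. temporal_tree n x u = S)"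
proof (cases "S \<subseteq> nary_tree n")
  case True
  then have "temporal_tree n x u = S \<longleftrightarrow> (\<forall>v\<in>nary_tree n. v \<in> temporal_tree n x u \<longleftrightarrow> v \<in> S)" for u
    using temporal_tree_subset[of n x u] by auto
  then show ?thesis
    by (simp only:, intro pred_intros_countable_bounded) auto
next
  case False
  then have "temporal_tree n x u \<noteq> S" for u
    using temporal_tree_subset[of n x u] by auto
  then show ?thesis
    by simp
qed

definition heavy_prob :: "nat \<Rightarrow> real \<Rightarrow> real \<Rightarrow> real \<Rightarrow> real" where
  "heavy_prob n p s c = labels.prob n {u \<in> space (label_measure n).
      tree_weight s (temporal_tree n p u) > ennreal (exp ((s + c) * (real n * p)))}"

definition light_prob :: "nat \<Rightarrow> real \<Rightarrow> real \<Rightarrow> real" where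
  "light_prob n p c = labels.prob n {u \<in> space (label_measure n). finite (temporal_tree n p u) \<and>
      real (card (temporal_tree n p u)) < exp ((1 - c) * (real n * p))}"

lemma heavy_prob_tendsto:
  assumes "0 < p" "p \<le> 1" "0 \<le> s" "0 < c"
  shows "(\<lambda>n. heavy_prob n p s c) \<longlonglongrightarrow> 0"
proof (rule tendsto_sandwich[where f = "\<lambda>_. 0"])
  show "(\<lambda>n. exp (- (c * p) * real n)) \<longlonglongrightarrow> 0"
    using assms by real_asymp
  have "heavy_prob n p s c \<le> exp (- (c * p) * real n)" for n
    using assms tree_weight_upper_tail[of p s n "(s + c) * (real n * p)"]
    by (simp add: heavy_prob_def algebra_simps)
  then show "\<forall>\<^sub>F n in sequentially. heavy_prob n p s c \<le> exp (- (c * p) * real n)"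
    by simp
qed (auto simp: heavy_prob_def)

text \<open>
  Giving up half of the exponent \<open>c\<close> leaves an interval of labels of length \<open>c * p / 2\<close>, and the
  other half absorbs the factor \<open>1 / 2\<close> of the lower tail bound.
\<close>

lemma light_prob_tendsto:
  assumes p: "0 < p" "p \<le> 1" and c: "0 < c" "c \<le> 1"
  shows "(\<lambda>n. light_prob n p c) \<longlonglongrightarrow> 0"
proof (rule tendsto_sandwich[where f = "\<lambda>_. 0"])
  define q where "q = c * p / 2"
  define y where "y = p - q"
  have q: "0 < q" "q \<le> 1 / 2" "q \<le> p"
    using p c mult_le_one[of c p] mult_right_mono[of c 1 p] by (auto simp: q_def)
  have y: "0 \<le> y" "y \<le> p"
    using q by (auto simp: y_def)
  have "0 \<le> 1 - q / 16" "1 - q / 16 < 1"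
    using q by auto
  then show "(\<lambda>n. (1 - q / 16) ^ n) \<longlonglongrightarrow> 0"
    by (rule LIMSEQ_realpow_zero)
  have "\<forall>\<^sub>F n in sequentially. 2 \<le> exp (q * real n)"
    using q by real_asymp
  then show "\<forall>\<^sub>F n in sequentially. light_prob n p c \<le> (1 - q / 16) ^ n"
  proof eventually_elim
    case (elim n)
    have "real n * y = (1 - c) * (real n * p) + q * real n"
      by (simp add: y_def q_def algebra_simps)
    then have "exp (real n * y) = exp ((1 - c) * (real n * p)) * exp (q * real n)"
      by (simp only: exp_add)
    moreover have "exp ((1 - c) * (real n * p)) * 2 \<le> exp ((1 - c) * (real n * p)) * exp (q * real n)"
      using elim by (intro mult_left_mono) auto
    ultimately have "exp ((1 - c) * (real n * p)) \<le> exp (real n * y) / 2"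
      by simp
    then have "light_prob n p c \<le> (1 - (p - y) / 16) ^ n"
      unfolding light_prob_def
      using y p by (intro card_temporal_tree_lower_tail) auto
    then show ?case
      by (simp add: y_def)
  qed
qed (auto simp: light_prob_def)

section \<open>Uniformly chosen vertices\<close>

text \<open>
  If all sets \<open>S\<close> with property \<open>G\<close> have only a share \<open>r\<close> of vertices with property \<open>A\<close>, then
  a uniform vertex has property \<open>A\<close> with probability at most \<open>r\<close> on the event \<open>G\<close>.  The conditional
  law is given on the elementary events \<open>T = S\<close>; they are summed up over the countably many
  finite sets \<open>S\<close>.
\<close>

lemma (in prob_space) prob_uniform_choice_le:
  assumes V: "uniform_choice M T V"
    and T [measurable]: "\<And>S. finite S \<Longrightarrow> Measurable.pred M (\<lambda>\<omega>. T \<omega> = S)"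
    and G: "\<And>S. G S \<Longrightarrow> finite S \<and> S \<noteq> {}"
      "\<And>S. G S \<Longrightarrow> real (card {v \<in> S. A v}) \<le> r * real (card S)"
    and r: "0 \<le> r"
  shows "prob {\<omega> \<in> space M. G (T \<omega>) \<and> A (V \<omega>)} \<le> r" and "{\<omega> \<in> space M. G (T \<omega>)} \<in> events"
proof -
  have V_meas [measurable]: "V \<in> M \<rightarrow>\<^sub>M count_space UNIV"
    using V by (simp add: uniform_choice_def)
  have [measurable]: "Measurable.pred M (\<lambda>\<omega>. B (V \<omega>))" for B
    by (rule measurable_compose[OF V_meas]) simp
  have given: "prob {\<omega> \<in> space M. T \<omega> = S \<and> A (V \<omega>)} \<le> r * prob {\<omega> \<in> space M. T \<omega> = S}"
    if "G S" for S
  proof (cases "prob {\<omega> \<in> space M. T \<omega> = S} = 0")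
    case True
    have S: "finite S"
      using G(1)[OF that] by simp
    have "prob {\<omega> \<in> space M. T \<omega> = S \<and> A (V \<omega>)} \<le> prob {\<omega> \<in> space M. T \<omega> = S}"
      using T[OF S] by (intro finite_measure_mono) auto
    then show ?thesis
      using True by simp
  next
    case False
    have S [simp]: "finite S" "S \<noteq> {}"
      using G(1)[OF that] by auto
    note [measurable] = T[OF S(1)]
    define t where "t = prob {\<omega> \<in> space M. T \<omega> = S}"
    have t: "0 < t"
      using False by (simp add: t_def zero_less_measure_iff)
    define Q where "Q v = {\<omega> \<in> space M. V \<omega> = v \<and> T \<omega> = S}" for v
    have [measurable]: "Q v \<in> events" for v
      unfolding Q_def by measurable
    have Q: "prob (Q v) = t / real (card S)" if "v \<in> S" for v
    proof -
      have "prob (Q v) / t = 1 / real (card S)"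
        using V S(1) t that unfolding uniform_choice_def cond_prob_def t_def Q_def by blast
      then show ?thesis
        using t by (simp add: field_simps)
    qed
    have sum_Q: "prob (\<Union>v\<in>F. Q v) = real (card F) * (t / real (card S))" if "F \<subseteq> S" for F
    proof -
      have "finite F"
        using that S(1) by (rule finite_subset)
      then have "prob (\<Union>v\<in>F. Q v) = (\<Sum>v\<in>F. prob (Q v))"
        by (intro finite_measure_finite_Union) (auto simp: disjoint_family_on_def Q_def)
      then show ?thesis
        using that Q by (simp add: subset_iff)
    qed
    \<comment> \<open>The masses of the vertices of \<open>S\<close> already add up to that of the event \<open>T = S\<close>, so
      \<open>V\<close> almost surely lies in \<open>S\<close> there.\<close>
    have out: "prob ({\<omega> \<in> space M. T \<omega> = S} - (\<Union>v\<in>S. Q v)) = 0"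
    proof -
      have "prob ({\<omega> \<in> space M. T \<omega> = S} - (\<Union>v\<in>S. Q v)) = t - prob (\<Union>v\<in>S. Q v)"
        unfolding t_def by (rule finite_measure_Diff) (auto simp: Q_def)
      then show ?thesis
        using sum_Q[of S] t by (simp add: card_gt_0_iff)
    qed
    have "prob {\<omega> \<in> space M. T \<omega> = S \<and> A (V \<omega>)}
        \<le> prob ((\<Union>v\<in>{v \<in> S. A v}. Q v) \<union> ({\<omega> \<in> space M. T \<omega> = S} - (\<Union>v\<in>S. Q v)))"
      by (rule finite_measure_mono) (auto simp: Q_def)
    also have "\<dots> \<le> prob (\<Union>v\<in>{v \<in> S. A v}. Q v) + prob ({\<omega> \<in> space M. T \<omega> = S} - (\<Union>v\<in>S. Q v))"
      by (rule measure_Un_le) auto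
    also have "\<dots> = real (card {v \<in> S. A v}) * (t / real (card S))"
      using sum_Q[of "{v \<in> S. A v}"] out by auto
    also have "\<dots> \<le> r * real (card S) * (t / real (card S))"
      using G(2)[OF that] t by (intro mult_right_mono) auto
    also have "\<dots> = r * t"
      by (simp add: card_gt_0_iff)
    finally show ?thesis
      by (simp add: t_def)
  qed
  let ?C = "Collect G"
  have cnt: "countable ?C"
    using G(1) by (intro countable_subset[OF _ countable_Collect_finite]) auto
  have meas: "{\<omega> \<in> space M. T \<omega> = S} \<in> events" "{\<omega> \<in> space M. T \<omega> = S \<and> A (V \<omega>)} \<in> events"
    if "S \<in> ?C" for S
    using G(1)[of S] that by auto
  have UT: "(\<Union>S\<in>?C. {\<omega> \<in> space M. T \<omega> = S}) = {\<omega> \<in> space M. G (T \<omega>)}"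
    by auto
  show "{\<omega> \<in> space M. G (T \<omega>)} \<in> events"
    unfolding UT[symmetric] using cnt meas by (intro sets.countable_UN') auto
  show "prob {\<omega> \<in> space M. G (T \<omega>) \<and> A (V \<omega>)} \<le> r"
  proof -
    have "emeasure M {\<omega> \<in> space M. G (T \<omega>) \<and> A (V \<omega>)}
        = emeasure M (\<Union>S\<in>?C. {\<omega> \<in> space M. T \<omega> = S \<and> A (V \<omega>)})"
      by (rule arg_cong[where f = "emeasure M"]) auto
    also have "\<dots> = (\<integral>\<^sup>+S. emeasure M {\<omega> \<in> space M. T \<omega> = S \<and> A (V \<omega>)} \<partial>count_space ?C)"
      using cnt meas by (intro emeasure_UN_countable) (auto simp: disjoint_family_on_def)
    also have "\<dots> \<le> (\<integral>\<^sup>+S. ennreal r * emeasure M {\<omega> \<in> space M. T \<omega> = S} \<partial>count_space ?C)"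
      using given r by (intro nn_integral_mono) (simp add: emeasure_eq_measure ennreal_mult[symmetric])
    also have "\<dots> = ennreal r * (\<integral>\<^sup>+S. emeasure M {\<omega> \<in> space M. T \<omega> = S} \<partial>count_space ?C)"
      by (rule nn_integral_cmult) simp
    also have "(\<integral>\<^sup>+S. emeasure M {\<omega> \<in> space M. T \<omega> = S} \<partial>count_space ?C)
        = emeasure M (\<Union>S\<in>?C. {\<omega> \<in> space M. T \<omega> = S})"
      using cnt meas by (intro emeasure_UN_countable[symmetric]) (auto simp: disjoint_family_on_def)
    also have "ennreal r * \<dots> \<le> ennreal r * 1"
      by (intro mult_left_mono emeasure_le_1) simp
    finally show ?thesis
      using r by (simp add: emeasure_eq_measure)
  qed
qed

section \<open>Depth of a uniform vertex\<close>

text \<open>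
  The rate in the Chernoff bound for the Poisson distribution.
\<close>

lemma entropy_gap_pos:
  fixes s :: real
  assumes "0 < s" "s \<noteq> 1"
  shows "0 < 1 - s + s * ln s"
proof -
  have "ln (1 / s) \<noteq> 1 / s - 1"
    using ln_eq_minus_one[of "1 / s"] assms by auto
  then have "ln (1 / s) < 1 / s - 1"
    using ln_le_minus_one[of "1 / s"] assms by simp
  then have "s * (- ln s) < s * (1 / s - 1)"
    using assms by (intro mult_strict_left_mono) (simp_all add: ln_div)
  then show ?thesis
    using assms by (simp add: algebra_simps)
qed

text \<open>
  The inequality \<open>exp (s * ln s * l) \<le> s ^ length v\<close> says that the depth of \<open>v\<close> lies on the far side
  of \<open>s * l\<close>: above it for \<open>s > 1\<close>, below it for \<open>s < 1\<close>.  In this form Markov's inequality for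
  the weight \<open>s ^ length v\<close> treats both tails at once.
\<close>

lemma card_atypical_depth_le:
  assumes S: "S \<subseteq> nary_tree n" "finite S" and s: "0 < s"
    and up: "tree_weight s S \<le> ennreal (exp ((s + c) * l))"
    and low: "exp ((1 - c) * l) \<le> real (card S)"
  shows "real (card {v \<in> S. exp (s * ln s * l) \<le> s ^ length v})
    \<le> exp (- (1 - s + s * ln s - 2 * c) * l) * real (card S)"
proof -
  let ?F = "{v \<in> S. exp (s * ln s * l) \<le> s ^ length v}"
  have "real (card ?F) * exp (s * ln s * l) \<le> (\<Sum>v\<in>?F. s ^ length v)"
    using sum_mono[of ?F "\<lambda>_. exp (s * ln s * l)" "\<lambda>v. s ^ length v"] by simp
  also have "\<dots> \<le> exp ((s + c) * l)"
  proof -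
    have "ennreal (\<Sum>v\<in>?F. s ^ length v) \<le> tree_weight s S"
      using S s by (intro sum_power_le_tree_weight) auto
    also note up
    finally show ?thesis
      by simp
  qed
  finally have "real (card ?F) \<le> exp ((s + c) * l) * exp (- (s * ln s * l))"
    by (simp add: exp_minus field_simps)
  also have "\<dots> = exp (- (1 - s + s * ln s - 2 * c) * l) * exp ((1 - c) * l)"
    by (simp add: algebra_simps flip: exp_add)
  also have "\<dots> \<le> exp (- (1 - s + s * ln s - 2 * c) * l) * real (card S)"
    using low by (intro mult_left_mono) auto
  finally show ?thesis .
qed

text \<open>
  The random tree for one fixed \<open>n\<close>, on an arbitrary probability space.
\<close>

locale uniform_vertex = prob_space M for M :: "'a measure" +
  fixes n :: nat and p :: real and U :: "nat list \<Rightarrow> 'a \<Rightarrow> real"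
    and T :: "'a \<Rightarrow> nat list set" and V :: "'a \<Rightarrow> nat list"
  assumes n: "1 \<le> n" and p: "0 < p" "p \<le> 1"
    and iid: "iid_uniform_labels M (nary_edges n) U"
    and T: "\<And>\<omega>. T \<omega> = temporal_tree n p (\<lambda>e. U e \<omega>)"
    and choice: "uniform_choice M T V"
begin

definition L :: "'a \<Rightarrow> nat list \<Rightarrow> real" where
  "L \<omega> = (\<lambda>e\<in>nary_edges n. U e \<omega>)"

lemma T_eq: "T \<omega> = temporal_tree n p (L \<omega>)"
  unfolding T L_def by (rule temporal_tree_cong) simp

lemma measurable_U: "e \<in> nary_edges n \<Longrightarrow> U e \<in> borel_measurable M"
  using iid by (simp add: iid_uniform_labels_def indep_vars_def)

lemma measurable_L [measurable]: "L \<in> M \<rightarrow>\<^sub>M label_measure n"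
proof -
  have "(\<lambda>\<omega>. \<lambda>e\<in>nary_edges n. U e \<omega>) \<in> M \<rightarrow>\<^sub>M (\<Pi>\<^sub>M e\<in>nary_edges n. borel)"
    by (intro measurable_restrict measurable_U)
  then show ?thesis
    by (simp add: L_def[abs_def] cong: measurable_cong_sets[OF refl sets_label_measure])
qed

lemma distr_L: "distr M (label_measure n) L = label_measure n"
proof -
  have "[0] \<in> nary_edges n"
    using n by simp
  then have ne: "nary_edges n \<noteq> {}"
    by blast
  have "distr M (label_measure n) L = distr M (\<Pi>\<^sub>M e\<in>nary_edges n. borel) (\<lambda>\<omega>. \<lambda>e\<in>nary_edges n. U e \<omega>)"
    by (rule distr_cong) (simp_all only: sets_label_measure L_def)
  also have "\<dots> = (\<Pi>\<^sub>M e\<in>nary_edges n. distr M borel (U e))"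
    using iid by (subst indep_vars_iff_distr_eq_PiM'[OF ne, symmetric])
      (auto simp: iid_uniform_labels_def measurable_U)
  also have "\<dots> = label_measure n"
    unfolding label_measure_def using iid by (intro PiM_cong) (auto simp: iid_uniform_labels_def)
  finally show ?thesis .
qed

lemma prob_L:
  assumes [measurable]: "Measurable.pred (label_measure n) Q"
  shows "prob {\<omega> \<in> space M. Q (L \<omega>)} = labels.prob n {u \<in> space (label_measure n). Q u}"
proof -
  have "labels.prob n {u \<in> space (label_measure n). Q u}
      = measure (distr M (label_measure n) L) {u \<in> space (label_measure n). Q u}"
    by (simp add: distr_L)
  also have "\<dots> = prob (L -` {u \<in> space (label_measure n). Q u} \<inter> space M)"
    by (rule measure_distr) measurable
  also have "L -` {u \<in> space (label_measure n). Q u} \<inter> space M = {\<omega> \<in> space M. Q (L \<omega>)}"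
    using measurable_space[OF measurable_L] by auto
  finally show ?thesis ..
qed

lemma measurable_V [measurable]: "V \<in> M \<rightarrow>\<^sub>M count_space UNIV"
  using choice by (simp add: uniform_choice_def)

lemma measurable_depth [measurable]: "(\<lambda>\<omega>. real (length (V \<omega>))) \<in> borel_measurable M"
  by (rule measurable_compose[OF measurable_V]) simp

lemma measurable_size [measurable]: "(\<lambda>\<omega>. real (card (T \<omega>))) \<in> borel_measurable M"
  unfolding T_eq by measurable

lemma measurable_T_eq: "Measurable.pred M (\<lambda>\<omega>. T \<omega> = S)"
  unfolding T_eq by (rule measurable_compose[OF measurable_L measurable_temporal_tree_eq])

lemma prob_heavy:
  "prob {\<omega> \<in> space M. tree_weight s (T \<omega>) > ennreal (exp ((s + c) * (real n * p)))} = heavy_prob n p s c"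
  unfolding T_eq heavy_prob_def by (rule prob_L) measurable

lemma prob_light:
  "prob {\<omega> \<in> space M. finite (T \<omega>) \<and> real (card (T \<omega>)) < exp ((1 - c) * (real n * p))} = light_prob n p c"
  unfolding T_eq light_prob_def by (rule prob_L) measurable

lemma measurable_weight_T [measurable]: "(\<lambda>\<omega>. tree_weight s (T \<omega>)) \<in> borel_measurable M"
  unfolding T_eq by measurable

lemma measurable_finite_T [measurable]: "Measurable.pred M (\<lambda>\<omega>. finite (T \<omega>))"
  unfolding T_eq by measurable

text \<open>
  The event \<open>tree_weight 1 (T \<omega>) > exp (2 * n * p)\<close>, of probability \<open>heavy_prob n p 1 1\<close>, is removed
  in order to make the tree finite.
\<close>

lemma prob_atypical_depth_le:
  assumes s: "0 < s"
  shows "prob {\<omega> \<in> space M. exp (s * ln s * (real n * p)) \<le> s ^ length (V \<omega>)}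
    \<le> heavy_prob n p 1 1 + heavy_prob n p s c + light_prob n p c + exp (- (1 - s + s * ln s - 2 * c) * (real n * p))"
proof -
  let ?l = "real n * p"
  define A where "A v \<longleftrightarrow> exp (s * ln s * ?l) \<le> s ^ length v" for v :: "nat list"
  define G where "G S \<longleftrightarrow> S \<subseteq> nary_tree n \<and> S \<noteq> {} \<and> finite S \<and>
      tree_weight s S \<le> ennreal (exp ((s + c) * ?l)) \<and> exp ((1 - c) * ?l) \<le> real (card S)" for S
  have G: "finite S \<and> S \<noteq> {}"
    "real (card {v \<in> S. A v}) \<le> exp (- (1 - s + s * ln s - 2 * c) * ?l) * real (card S)"
    if "G S" for S
    using that s card_atypical_depth_le[of S n s c ?l] by (auto simp: G_def A_def)
  note uc = prob_uniform_choice_le[OF choice measurable_T_eq, of G A, OF G exp_ge_zero]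
  let ?H1 = "{\<omega> \<in> space M. tree_weight 1 (T \<omega>) > ennreal (exp ((1 + 1) * ?l))}"
  let ?Hs = "{\<omega> \<in> space M. tree_weight s (T \<omega>) > ennreal (exp ((s + c) * ?l))}"
  let ?B = "{\<omega> \<in> space M. finite (T \<omega>) \<and> real (card (T \<omega>)) < exp ((1 - c) * ?l)}"
  let ?C = "{\<omega> \<in> space M. G (T \<omega>) \<and> A (V \<omega>)}"
  have A_meas [measurable]: "Measurable.pred M (\<lambda>\<omega>. A (V \<omega>))"
    by (rule measurable_compose[OF measurable_V]) simp
  have [measurable]: "?H1 \<in> events" "?Hs \<in> events" "?B \<in> events"
    by measurable
  have [measurable]: "Measurable.pred M (\<lambda>\<omega>. G (T \<omega>))"
    using uc(2) by (simp add: pred_def)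
  have [measurable]: "?C \<in> events"
    by measurable
  have "{\<omega> \<in> space M. A (V \<omega>)} \<subseteq> ((?H1 \<union> ?Hs) \<union> ?B) \<union> ?C"
  proof (rule subsetI, rule ccontr)
    fix \<omega> assume w: "\<omega> \<in> {\<omega> \<in> space M. A (V \<omega>)}" "\<omega> \<notin> ((?H1 \<union> ?Hs) \<union> ?B) \<union> ?C"
    have T: "T \<omega> \<subseteq> nary_tree n" "T \<omega> \<noteq> {}"
      using temporal_tree_subset Nil_in_temporal_tree unfolding T_eq by (blast, metis empty_iff)
    moreover have "finite (T \<omega>)"
      using tree_weight_1_bound(1)[OF T(1), of "exp ((1 + 1) * ?l)"] w by (simp add: not_less)
    ultimately show False
      using w by (auto simp: G_def not_less)
  qed
  then have "prob {\<omega> \<in> space M. A (V \<omega>)} \<le> prob (((?H1 \<union> ?Hs) \<union> ?B) \<union> ?C)"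
    by (rule finite_measure_mono) measurable
  also have "\<dots> \<le> ((prob ?H1 + prob ?Hs) + prob ?B) + prob ?C"
    by (intro order_trans[OF measure_Un_le] add_mono order_refl) measurable
  finally show ?thesis
    using uc(1) prob_heavy[of 1 1] prob_heavy[of s c] prob_light[of c] by (simp add: A_def)
qed

lemma prob_depth_deviation_le:
  assumes e: "0 < \<epsilon>" "\<epsilon> < 1"
  shows "prob {\<omega> \<in> space M. \<bar>real (length (V \<omega>)) / (real n * p) - 1\<bar> > \<epsilon>}
    \<le> (\<Sum>s\<in>{1 - \<epsilon>, 1 + \<epsilon>}.
        prob {\<omega> \<in> space M. exp (s * ln s * (real n * p)) \<le> s ^ length (V \<omega>)})"
proof -
  let ?l = "real n * p"
  let ?A = "\<lambda>s. {\<omega> \<in> space M. exp (s * ln s * ?l) \<le> s ^ length (V \<omega>)}"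
  have l: "0 < ?l"
    using n p by simp
  have [measurable]: "?A s \<in> events" for s
  proof -
    have "Measurable.pred M (\<lambda>\<omega>. exp (s * ln s * ?l) \<le> s ^ length (V \<omega>))"
      by (rule measurable_compose[OF measurable_V]) simp
    then show ?thesis
      by (simp add: pred_def)
  qed
  have A: "exp (s * ln s * ?l) \<le> s ^ d" if "0 < s" "s * ?l * ln s \<le> real d * ln s" for s d
  proof -
    have "exp (s * ln s * ?l) \<le> exp (real d * ln s)"
      using that by (simp add: mult_ac)
    also have "\<dots> = s ^ d"
      using that by (simp add: exp_of_nat_mult)
    finally show ?thesis .
  qed
  have "{\<omega> \<in> space M. \<bar>real (length (V \<omega>)) / ?l - 1\<bar> > \<epsilon>} \<subseteq> ?A (1 - \<epsilon>) \<union> ?A (1 + \<epsilon>)"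
  proof
    fix \<omega> assume w: "\<omega> \<in> {\<omega> \<in> space M. \<bar>real (length (V \<omega>)) / ?l - 1\<bar> > \<epsilon>}"
    then consider "real (length (V \<omega>)) \<le> (1 - \<epsilon>) * ?l" | "(1 + \<epsilon>) * ?l \<le> real (length (V \<omega>))"
    proof -
      have "real (length (V \<omega>)) / ?l < 1 - \<epsilon> \<or> 1 + \<epsilon> < real (length (V \<omega>)) / ?l"
        using w by (auto simp: abs_if split: if_splits)
      then show ?thesis
        using l that by (auto simp: pos_divide_less_eq pos_less_divide_eq less_imp_le)
    qed
    then show "\<omega> \<in> ?A (1 - \<epsilon>) \<union> ?A (1 + \<epsilon>)"
    proof cases
      case 1
      then have "(1 - \<epsilon>) * ?l * ln (1 - \<epsilon>) \<le> real (length (V \<omega>)) * ln (1 - \<epsilon>)"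
        using e by (intro mult_right_mono_neg) auto
      then show ?thesis
        using A[of "1 - \<epsilon>" "length (V \<omega>)"] e w by simp
    next
      case 2
      then have "(1 + \<epsilon>) * ?l * ln (1 + \<epsilon>) \<le> real (length (V \<omega>)) * ln (1 + \<epsilon>)"
        using e by (intro mult_right_mono) auto
      then show ?thesis
        using A[of "1 + \<epsilon>" "length (V \<omega>)"] e w by simp
    qed
  qed
  then have "prob {\<omega> \<in> space M. \<bar>real (length (V \<omega>)) / ?l - 1\<bar> > \<epsilon>} \<le> prob (?A (1 - \<epsilon>) \<union> ?A (1 + \<epsilon>))"
    by (rule finite_measure_mono) measurable
  also have "\<dots> \<le> prob (?A (1 - \<epsilon>)) + prob (?A (1 + \<epsilon>))"
    by (rule measure_Un_le) measurable
  finally show ?thesis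
    using e by simp
qed

text \<open>
  Outside the three exceptional events both the depth and the logarithm of the size lie within
  \<open>\<eta> * n * p\<close> of \<open>n * p\<close>.
\<close>

lemma prob_depth_over_log_size_deviation_le:
  assumes e: "0 < \<epsilon>" and \<eta>: "0 < \<eta>" "\<eta> \<le> 1 / 2" "4 * \<eta> \<le> \<epsilon>"
  shows "prob {\<omega> \<in> space M. \<bar>real (length (V \<omega>)) / ln (real (card (T \<omega>))) - 1\<bar> > \<epsilon>}
    \<le> prob {\<omega> \<in> space M. \<bar>real (length (V \<omega>)) / (real n * p) - 1\<bar> > \<eta>} + heavy_prob n p 1 \<eta> + light_prob n p \<eta>"
proof -
  let ?l = "real n * p"
  have l: "0 < ?l"
    using n p by simp
  let ?D = "{\<omega> \<in> space M. \<bar>real (length (V \<omega>)) / ?l - 1\<bar> > \<eta>}"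
  let ?H = "{\<omega> \<in> space M. tree_weight 1 (T \<omega>) > ennreal (exp ((1 + \<eta>) * ?l))}"
  let ?B = "{\<omega> \<in> space M. finite (T \<omega>) \<and> real (card (T \<omega>)) < exp ((1 - \<eta>) * ?l)}"
  have [measurable]: "?D \<in> events" "?H \<in> events" "?B \<in> events"
    by measurable
  have "{\<omega> \<in> space M. \<bar>real (length (V \<omega>)) / ln (real (card (T \<omega>))) - 1\<bar> > \<epsilon>} \<subseteq> ?D \<union> ?H \<union> ?B"
  proof (rule subsetI, rule ccontr)
    fix \<omega> assume w: "\<omega> \<in> {\<omega> \<in> space M. \<bar>real (length (V \<omega>)) / ln (real (card (T \<omega>))) - 1\<bar> > \<epsilon>}"
      and w': "\<omega> \<notin> ?D \<union> ?H \<union> ?B"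
    have "T \<omega> \<subseteq> nary_tree n"
      using temporal_tree_subset unfolding T_eq by blast
    moreover have "tree_weight 1 (T \<omega>) \<le> ennreal (exp ((1 + \<eta>) * ?l))"
      using w w' by auto
    ultimately have up: "finite (T \<omega>)" "real (card (T \<omega>)) \<le> exp ((1 + \<eta>) * ?l)"
      using tree_weight_1_bound by auto
    then have low: "exp ((1 - \<eta>) * ?l) \<le> real (card (T \<omega>))"
      using w w' by auto
    define d where "d = real (length (V \<omega>))"
    define k where "k = ln (real (card (T \<omega>)))"
    have card: "0 < real (card (T \<omega>))"
      using low exp_gt_zero less_le_trans by blast
    have k: "(1 - \<eta>) * ?l \<le> k" "k \<le> (1 + \<eta>) * ?l"
      using low up(2) card ln_le_cancel_iff[of "exp ((1 - \<eta>) * ?l)" "real (card (T \<omega>))"]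
        ln_le_cancel_iff[of "real (card (T \<omega>))" "exp ((1 + \<eta>) * ?l)"]
      unfolding k_def by simp_all
    have "\<bar>d / ?l - 1\<bar> \<le> \<eta>"
      using w w' by (simp add: d_def)
    then have d: "(1 - \<eta>) * ?l \<le> d" "d \<le> (1 + \<eta>) * ?l"
    proof -
      have "1 - \<eta> \<le> d / ?l" "d / ?l \<le> 1 + \<eta>"
        using \<open>\<bar>d / ?l - 1\<bar> \<le> \<eta>\<close> by (simp_all add: abs_le_iff algebra_simps)
      then show "(1 - \<eta>) * ?l \<le> d" "d \<le> (1 + \<eta>) * ?l"
        using l by (auto simp only: pos_le_divide_eq pos_divide_le_eq)
    qed
    have "?l / 2 \<le> (1 - \<eta>) * ?l"
      using mult_right_mono[of "1 / 2" "1 - \<eta>" ?l] \<eta>(2) l by simp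
    then have k2: "?l / 2 \<le> k" "0 < k"
      using k l by auto
    have "\<bar>d - k\<bar> \<le> 2 * \<eta> * ?l"
      using k d by (simp add: abs_le_iff algebra_simps)
    also have "\<dots> = 4 * \<eta> * (?l / 2)"
      by simp
    also have "\<dots> \<le> \<epsilon> * k"
      using \<eta> e k2 l by (intro mult_mono) auto
    finally have "\<bar>d / k - 1\<bar> \<le> \<epsilon>"
      using k2(2) by (simp add: abs_le_iff field_simps)
    then show False
      using w by (simp add: d_def k_def)
  qed
  then have "prob {\<omega> \<in> space M. \<bar>real (length (V \<omega>)) / ln (real (card (T \<omega>))) - 1\<bar> > \<epsilon>}
      \<le> prob (?D \<union> ?H \<union> ?B)"
    by (rule finite_measure_mono) measurable
  also have "\<dots> \<le> (prob ?D + prob ?H) + prob ?B"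
    by (intro order_trans[OF measure_Un_le] add_mono order_refl) measurable
  finally show ?thesis
    using prob_heavy[of 1 \<eta>] prob_light[of \<eta>] by simp
qed

end

theorem theorem2p3:
  fixes p :: real
    and M :: "nat \<Rightarrow> 'a measure"
    and U :: "nat \<Rightarrow> nat list \<Rightarrow> 'a \<Rightarrow> real"
    and T :: "nat \<Rightarrow> 'a \<Rightarrow> nat list set"
    and V :: "nat \<Rightarrow> 'a \<Rightarrow> nat list"
    and D :: "nat \<Rightarrow> 'a \<Rightarrow> nat"
  assumes "0 < p" and "p \<le> 1"
    and "\<And>n. n \<ge> 1 \<Longrightarrow> prob_space (M n)"
    and "\<And>n. n \<ge> 1 \<Longrightarrow> iid_uniform_labels (M n) (nary_edges n) (U n)"
    and "\<And>n \<omega>. T n \<omega> = temporal_tree n p (\<lambda>e. U n e \<omega>)"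
    and "\<And>n. n \<ge> 1 \<Longrightarrow> uniform_choice (M n) (T n) (V n)"
    and "\<And>n \<omega>. D n \<omega> = length (V n \<omega>)"
  shows "converges_in_probability M (\<lambda>n \<omega>. real (D n \<omega>) / (real n * p)) 1
       \<and> converges_in_probability M (\<lambda>n \<omega>. real (D n \<omega>) / ln (real (card (T n \<omega>)))) 1"
proof -
  have uv: "uniform_vertex (M n) n p (U n) (T n) (V n)" if "1 \<le> n" for n
    using that assms by (auto simp: uniform_vertex_def uniform_vertex_axioms_def)
  have D: "D n = (\<lambda>\<omega>. length (V n \<omega>))" for n
    using assms(7) by auto
  let ?A = "\<lambda>s n. measure (M n) {\<omega> \<in> space (M n). exp (s * ln s * (real n * p)) \<le> s ^ length (V n \<omega>)}"
  have atypical: "?A s \<longlonglongrightarrow> 0" if s: "0 < s" "s \<noteq> 1" for s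
  proof (rule tendsto_sandwich[where f = "\<lambda>_. 0"])
    define h where "h = 1 - s + s * ln s"
    \<comment> \<open>The errors in the bounds for the weight and for the size cost \<open>c\<close> each, so
      \<open>2 * c < h\<close> leaves an exponential gain.\<close>
    define c where "c = min 1 (h / 4)"
    have h: "0 < h"
      unfolding h_def by (rule entropy_gap_pos[OF s])
    have c: "0 < c" "c \<le> 1" "0 < h - 2 * c"
      using h by (auto simp: c_def)
    show "\<forall>\<^sub>F n in sequentially. ?A s n \<le> heavy_prob n p 1 1 + heavy_prob n p s c
      + light_prob n p c + exp (- (h - 2 * c) * (real n * p))"
      using eventually_ge_at_top[of 1] unfolding h_def
      by eventually_elim (rule uniform_vertex.prob_atypical_depth_le[OF uv s(1)])
    have "(\<lambda>n. exp (- (h - 2 * c) * (real n * p))) \<longlonglongrightarrow> 0"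
    proof -
      define q where "q = (h - 2 * c) * p"
      have "0 < q"
        using c(3) assms(1) by (simp add: q_def)
      moreover have "- (h - 2 * c) * (real n * p) = - q * real n" for n
        by (simp add: q_def algebra_simps)
      ultimately show ?thesis
        by (simp only:) real_asymp
    qed
    then have "(\<lambda>n. heavy_prob n p 1 1 + heavy_prob n p s c
      + light_prob n p c + exp (- (h - 2 * c) * (real n * p))) \<longlonglongrightarrow> 0 + 0 + 0 + 0"
      using c s by (intro tendsto_add heavy_prob_tendsto light_prob_tendsto assms(1,2)) auto
    then show "(\<lambda>n. heavy_prob n p 1 1 + heavy_prob n p s c
      + light_prob n p c + exp (- (h - 2 * c) * (real n * p))) \<longlonglongrightarrow> 0"
      by simp
  qed auto
  let ?D = "\<lambda>e n. measure (M n) {\<omega> \<in> space (M n). \<bar>real (length (V n \<omega>)) / (real n * p) - 1\<bar> > e}"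
  have depth: "?D e \<longlonglongrightarrow> 0" if e: "0 < e" for e
  proof (rule tendsto_sandwich[where f = "\<lambda>_. 0"])
    define e' where "e' = min e (1 / 2)"
    have e': "0 < e'" "e' < 1" "e' \<le> e"
      using e by (auto simp: e'_def)
    show "(\<lambda>n. \<Sum>s\<in>{1 - e', 1 + e'}. ?A s n) \<longlonglongrightarrow> 0"
      using e' by (intro tendsto_null_sum atypical) auto
    show "\<forall>\<^sub>F n in sequentially. ?D e n \<le> (\<Sum>s\<in>{1 - e', 1 + e'}. ?A s n)"
      using eventually_ge_at_top[of 1]
    proof eventually_elim
      case (elim n)
      interpret uniform_vertex "M n" n p "U n" "T n" "V n"
        by (rule uv[OF elim])
      have "?D e n \<le> ?D e' n"
        using e' by (intro finite_measure_mono) auto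
      also have "\<dots> \<le> (\<Sum>s\<in>{1 - e', 1 + e'}. ?A s n)"
        by (rule prob_depth_deviation_le[OF e'(1,2)])
      finally show ?case .
    qed
  qed auto
  let ?R = "\<lambda>e n. measure (M n) {\<omega> \<in> space (M n).
      \<bar>real (length (V n \<omega>)) / ln (real (card (T n \<omega>))) - 1\<bar> > e}"
  have ratio: "?R e \<longlonglongrightarrow> 0" if e: "0 < e" for e
  proof (rule tendsto_sandwich[where f = "\<lambda>_. 0"])
    define \<eta> where "\<eta> = min (1 / 2) (e / 4)"
    have \<eta>: "0 < \<eta>" "\<eta> \<le> 1 / 2" "4 * \<eta> \<le> e"
      using e by (auto simp: \<eta>_def)
    show "\<forall>\<^sub>F n in sequentially. ?R e n
        \<le> ?D \<eta> n + heavy_prob n p 1 \<eta> + light_prob n p \<eta>"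
      using eventually_ge_at_top[of 1]
      by eventually_elim (rule uniform_vertex.prob_depth_over_log_size_deviation_le[OF uv e \<eta>])
    have "(\<lambda>n. ?D \<eta> n + heavy_prob n p 1 \<eta> + light_prob n p \<eta>) \<longlonglongrightarrow> 0 + 0 + 0"
      using \<eta> by (intro tendsto_add depth heavy_prob_tendsto light_prob_tendsto assms(1,2)) auto
    then show "(\<lambda>n. ?D \<eta> n + heavy_prob n p 1 \<eta> + light_prob n p \<eta>) \<longlonglongrightarrow> 0"
      by simp
  qed auto
  have "\<forall>\<^sub>F n in sequentially. (\<lambda>\<omega>. real (length (V n \<omega>)) / (real n * p)) \<in> borel_measurable (M n)
      \<and> (\<lambda>\<omega>. real (length (V n \<omega>)) / ln (real (card (T n \<omega>)))) \<in> borel_measurable (M n)"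
    using eventually_ge_at_top[of 1]
  proof eventually_elim
    case (elim n)
    interpret uniform_vertex "M n" n p "U n" "T n" "V n"
      by (rule uv[OF elim])
    show ?case
      by measurable
  qed
  then show ?thesis
    unfolding converges_in_probability_def D
    using depth ratio by (auto simp: eventually_conj_iff)
qed

end
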